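(* Let $m\ge1$, $t^0,s^0\in\mathbb{R}$, $\widetilde\eta>0$, $\mu\in\mathbb{R}$, $h=2\widetilde\eta$. Let $f:\mathbb{R}\times\mathbb{R}^m\times\mathbb{R}^m\to\mathbb{R}^m$ and $G:\mathbb{R}^m\to\mathbb{R}$ be Lipschitz with $|G(y)|\le\mu\widetilde\eta<\frac12$ for all $y\in\mathbb{R}^m$. Let $(y,\eta)$ be the solution of the state-dependent delay system with data $g\in C^1([t^0-h,t^0];\mathbb{R}^m)$, $\eta^0\in(0,2\widetilde\eta]$, let $\omega$ be an admissible initial time function for $\eta^0$, let $\alpha$ be the associated time transformation and $z(s)=y(\alpha(s))$, $s\ge s^0-h$. Assume that $\alpha(s)\to+\infty$ as $s\to+\infty$. Write $y_t(\theta)=y(t+\theta)$ and $z_s(\theta)=z(s+\theta)$, $\theta\in[-h,0]$. Then: 1. If $\{y_t\}_{t\ge t_1}$ is contained in a precompact subset of $C([-h,0];\mathbb{R}^m)$ for some $t_1\ge t^0$, and $\alpha$ is uniformly continuous on $[s_1,+\infty)$ for some $s_1\ge s^0$, then for some $s_2\ge s^0$ the family $\{z_s\}_{s\ge s_2}$ is contained in a precompact subset of $C([-h,0];\mathbb{R}^m)$. 2. Conversely, if $\{z_s\}_{s\ge s_1}$ is contained in a precompact subset of $C([-h,0];\mathbb{R}^m)$ for some $s_1\ge s^0$, and $\alpha^{-1}$ is uniformly continuous on $[t_1,+\infty)$ for some $t_1\ge t^0$, then for some $t_2\ge t^0$ the family $\{y_t\}_{t\ge t_2}$ is contained in a precompact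 subset of $C([-h,0];\mathbb{R}^m)$. 3. If $\{y_t\}_{t\ge t_1}$ is contained in a precompact subset of $C^1([-h,0];\mathbb{R}^m)$ for some $t_1\ge t^0$, and for some $s_1\ge s^0$ the function $\alpha$ is $C^1$ on $[s_1,\infty)$, $\dot\alpha$ is bounded above on $[s_1,\infty)$, and $\alpha$ and $\dot\alpha$ are uniformly continuous on $[s_1,\infty)$, then for some $s_2\ge s^0$ the family $\{z_s\}_{s\ge s_2}$ is contained in a precompact subset of $C^1([-h,0];\mathbb{R}^m)$. 4. Conversely, if $\{z_s\}_{s\ge s_1}$ is contained in a precompact subset of $C^1([-h,0];\mathbb{R}^m)$ for some $s_1\ge s^0$, and for some $t_1\ge t^0$ the function $\alpha^{-1}$ is $C^1$ on $[t_1,\infty)$, its derivative is bounded above on $[t_1,\infty)$, and $\alpha^{-1}$ and its derivative are uniformly continuous on $[t_1,\infty)$, then for some $t_2\ge t^0$ the family $\{y_t\}_{t\ge t_2}$ is contained in a precompact subset of $C^1([-h,0];\mathbb{R}^m)$.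
   Context: State-dependent delay system. For $(g,\eta^0)$ consider $$\dot y(t)=f(t,y(t),y(t-\eta(t))),\qquad \dot\eta(t)=-\mu(\eta(t)-\widetilde\eta)+G(y(t)),\qquad t>t^0,$$ with $y(t)=g(t)$ for $t\in[t^0-h,t^0]$ and $\eta(t^0)=\eta^0$. A solution is a pair of continuous functions $y:[t^0-h,\infty)\to\mathbb{R}^m$, $\eta:[t^0,\infty)\to\mathbb{R}$, satisfying the initial conditions, $C^1$ on $[t^0,\infty)$ (one-sided derivative at $t^0$) and satisfying the equations. Under the stated hypotheses it exists, is unique, satisfies $\eta(t)\in[0,2\widetilde\eta]$ for all $t\ge t^0$, and the deviating argument $\sigma(t)=t-\eta(t)$ satisfies $\dot\sigma(t)>0$ for $t\ge t^0$. Admissible initial time function for $\eta^0$: a $C^1$ function $\omega:[s^0-h,s^0]\to\mathbb{R}$ with $\dot\omega>0$, $\omega(s^0)=t^0$ and $\omega(s^0-h)=t^0-\eta^0<t^0$. Time transformation: $\alpha:[s^0-h,\infty)\to\mathbb{R}$ is defined by $\alpha(s)=\omega(s)$ on $[s^0-h,s^0]$ and, step by step on intervals of length $h$, $\alpha(s)=\sigma^{-1}(\alpha(s-h))$ for $s\ge s^0$. It is continuous and strictly increasing; $\alpha^{-1}$ denotes its inverse. *)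

theory Defs
  imports "HOL-Analysis.Analysis"
begin

section \<open>One-sided \<open>C\<^sup>1\<close> functions\<close>

text \<open>The library notion \<open>C1_differentiable_on\<close> asks for two-sided derivatives at every point
  of the set. Here derivatives are taken within the set, so that they are one-sided at the
  endpoints of an interval and independent of the values outside of it.\<close>

definition C1_on :: "real set \<Rightarrow> (real \<Rightarrow> 'a::real_normed_vector) \<Rightarrow> bool" where
  "C1_on S u \<longleftrightarrow>
     (\<exists>D. (\<forall>x\<in>S. (u has_vector_derivative D x) (at x within S)) \<and> continuous_on S D)"

definition deriv_on :: "real set \<Rightarrow> (real \<Rightarrow> 'a::real_normed_vector) \<Rightarrow> real \<Rightarrow> 'a" where
  "deriv_on S u x = vector_derivative u (at x within S)"


section \<open>The metric spaces \<open>C([a,b])\<close> and \<open>C\<^sup>1([a,b])\<close>\<close>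

text \<open>Functions on \<open>[a,b]\<close> are represented by their extensional representatives, so that equality
  of elements is equality on \<open>[a,b]\<close>.\<close>

definition C_space :: "real \<Rightarrow> real \<Rightarrow> (real \<Rightarrow> 'a::real_normed_vector) set" where
  "C_space a b = {u. u \<in> extensional {a..b} \<and> continuous_on {a..b} u}"

definition C1_space :: "real \<Rightarrow> real \<Rightarrow> (real \<Rightarrow> 'a::real_normed_vector) set" where
  "C1_space a b = {u. u \<in> extensional {a..b} \<and> C1_on {a..b} u}"

text \<open>The value outside the carrier is irrelevant; it is set to 0 because the library locale
  for metric spaces requires nonnegativity of the distance on the whole type.\<close>

definition C_dist :: "real \<Rightarrow> real \<Rightarrow> (real \<Rightarrow> 'a::real_normed_vector) \<Rightarrow> (real \<Rightarrow> 'a) \<Rightarrow> real" where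
  "C_dist a b u v =
     (if u \<in> C_space a b \<and> v \<in> C_space a b then (SUP x\<in>{a..b}. norm (u x - v x)) else 0)"

definition C1_dist :: "real \<Rightarrow> real \<Rightarrow> (real \<Rightarrow> 'a::real_normed_vector) \<Rightarrow> (real \<Rightarrow> 'a) \<Rightarrow> real" where
  "C1_dist a b u v =
     C_dist a b u v +
     C_dist a b (restrict (deriv_on {a..b} u) {a..b}) (restrict (deriv_on {a..b} v) {a..b})"

definition C_metric :: "real \<Rightarrow> real \<Rightarrow> (real \<Rightarrow> 'a::real_normed_vector) metric" where
  "C_metric a b = metric (C_space a b, C_dist a b)"

definition C1_metric :: "real \<Rightarrow> real \<Rightarrow> (real \<Rightarrow> 'a::real_normed_vector) metric" where
  "C1_metric a b = metric (C1_space a b, C1_dist a b)"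

definition precompact_in :: "'a metric \<Rightarrow> 'a set \<Rightarrow> bool" where
  "precompact_in m P \<longleftrightarrow>
     P \<subseteq> mspace m \<and> compactin (mtopology_of m) (mtopology_of m closure_of P)"

lemma C_dist_upper:
  assumes "u \<in> C_space a b" "v \<in> C_space a b" "x \<in> {a..b}"
  shows "norm (u x - v x) \<le> C_dist a b u v"
proof -
  have "continuous_on {a..b} (\<lambda>x. norm (u x - v x))"
    using assms by (auto simp: C_space_def intro!: continuous_intros)
  then have "bdd_above ((\<lambda>x. norm (u x - v x)) ` {a..b})"
    by (meson bounded_imp_bdd_above compact_Icc compact_continuous_image compact_imp_bounded)
  then show ?thesis
    using assms by (auto simp: C_dist_def intro: cSUP_upper)
qed

lemma C_dist_least:
  assumes "a \<le> b" "u \<in> C_space a b" "v \<in> C_space a b"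
    and "\<And>x. x \<in> {a..b} \<Longrightarrow> norm (u x - v x) \<le> B"
  shows "C_dist a b u v \<le> B"
  using assms by (auto simp: C_dist_def intro!: cSUP_least)

lemma Metric_space_C:
  assumes "a \<le> b"
  shows "Metric_space (C_space a b) (C_dist a b)"
proof
  fix u v w :: "real \<Rightarrow> 'a"
  show "0 \<le> C_dist a b u v"
  proof (cases "u \<in> C_space a b \<and> v \<in> C_space a b")
    case True
    then have "norm (u a - v a) \<le> C_dist a b u v"
      using assms by (intro C_dist_upper) auto
    then show ?thesis
      using norm_ge_zero order_trans by blast
  qed (auto simp: C_dist_def)
  show "C_dist a b u v = C_dist a b v u"
    by (auto simp: C_dist_def norm_minus_commute)
  assume u: "u \<in> C_space a b" and v: "v \<in> C_space a b"
  show "C_dist a b u v = 0 \<longleftrightarrow> u = v"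
  proof
    assume d: "C_dist a b u v = 0"
    show "u = v"
    proof
      fix x show "u x = v x"
      proof (cases "x \<in> {a..b}")
        case True
        then show ?thesis using C_dist_upper[OF u v True] d by auto
      next
        case False
        then show ?thesis using u v by (auto simp: C_space_def extensional_def)
      qed
    qed
  next
    assume "u = v"
    then show "C_dist a b u v = 0"
      using assms by (auto simp: C_dist_def)
  qed
  assume w: "w \<in> C_space a b"
  show "C_dist a b u w \<le> C_dist a b u v + C_dist a b v w"
  proof (rule C_dist_least[OF assms u w])
    fix x assume x: "x \<in> {a..b}"
    show "norm (u x - w x) \<le> C_dist a b u v + C_dist a b v w"
      using C_dist_upper[OF u v x] C_dist_upper[OF v w x] norm_triangle_ineq[of "u x - v x" "v x - w x"]
      by simp
  qed
qed

lemma C1_on_imp_continuous_on: "C1_on S u \<Longrightarrow> continuous_on S u"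
  unfolding C1_on_def by (metis continuous_on_vector_derivative)

lemma C1_space_subset: "C1_space a b \<subseteq> C_space a b"
  by (auto simp: C1_space_def C_space_def C1_on_imp_continuous_on)

lemma deriv_on_in_C_space:
  assumes "a < b" "u \<in> C1_space a b"
  shows "restrict (deriv_on {a..b} u) {a..b} \<in> C_space a b"
proof -
  obtain D where D: "\<And>x. x \<in> {a..b} \<Longrightarrow> (u has_vector_derivative D x) (at x within {a..b})"
    and cont: "continuous_on {a..b} D"
    using assms(2) unfolding C1_space_def C1_on_def by blast
  have "deriv_on {a..b} u x = D x" if "x \<in> {a..b}" for x
    unfolding deriv_on_def
    using D[OF that] assms(1) that 
    by (metis islimpt_Icc trivial_limit_within vector_derivative_within)
  then have "continuous_on {a..b} (restrict (deriv_on {a..b} u) {a..b})"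
    using cont by (subst continuous_on_cong[OF refl, where g = D]) auto
  then show ?thesis by (simp add: C_space_def)
qed

lemma Metric_space_C1:
  assumes "a < b"
  shows "Metric_space (C1_space a b) (C1_dist a b)"
proof -
  interpret C: Metric_space "C_space a b :: (real \<Rightarrow> 'a) set" "C_dist a b"
    using assms by (intro Metric_space_C) auto
  let ?d = "\<lambda>u :: real \<Rightarrow> 'a. restrict (deriv_on {a..b} u) {a..b}"
  note m = subsetD[OF C1_space_subset] deriv_on_in_C_space[OF assms]
  show ?thesis
  proof
    fix u v w :: "real \<Rightarrow> 'a"
    show "0 \<le> C1_dist a b u v"
      by (simp add: C1_dist_def)
    show "C1_dist a b u v = C1_dist a b v u"
      by (simp add: C1_dist_def C.commute)
    assume u: "u \<in> C1_space a b" and v: "v \<in> C1_space a b"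
    show "C1_dist a b u v = 0 \<longleftrightarrow> u = v"
      using C.zero[OF m(1)[OF u] m(1)[OF v]] C.zero[OF m(2)[OF u] m(2)[OF v]]
        C.nonneg[of u v] C.nonneg[of "?d u" "?d v"]
      unfolding C1_dist_def by (metis add_nonneg_eq_0_iff)
    assume w: "w \<in> C1_space a b"
    show "C1_dist a b u w \<le> C1_dist a b u v + C1_dist a b v w"
      using C.triangle[OF m(1)[OF u] m(1)[OF v] m(1)[OF w]]
        C.triangle[OF m(2)[OF u] m(2)[OF v] m(2)[OF w]]
      unfolding C1_dist_def by linarith
  qed
qed

lemma mspace_C_metric [simp]: "a \<le> b \<Longrightarrow> mspace (C_metric a b) = C_space a b"
  and mdist_C_metric [simp]: "a \<le> b \<Longrightarrow> mdist (C_metric a b) = C_dist a b"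
  by (simp_all add: C_metric_def Metric_space.mspace_metric Metric_space.mdist_metric Metric_space_C)

lemma mspace_C1_metric [simp]: "a < b \<Longrightarrow> mspace (C1_metric a b) = C1_space a b"
  and mdist_C1_metric [simp]: "a < b \<Longrightarrow> mdist (C1_metric a b) = C1_dist a b"
  by (simp_all add: C1_metric_def Metric_space.mspace_metric Metric_space.mdist_metric Metric_space_C1)


section \<open>The state-dependent delay system\<close>

definition segment :: "real \<Rightarrow> (real \<Rightarrow> 'a) \<Rightarrow> real \<Rightarrow> (real \<Rightarrow> 'a)" where
  "segment h x t = restrict (\<lambda>\<theta>. x (t + \<theta>)) {-h..0}"

definition SDD_solution ::
  "(real \<times> 'a::real_normed_vector \<times> 'a \<Rightarrow> 'a) \<Rightarrow> ('a \<Rightarrow> real) \<Rightarrow> real \<Rightarrow> real \<Rightarrow> real \<Rightarrow> real \<Rightarrow>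
   (real \<Rightarrow> 'a) \<Rightarrow> real \<Rightarrow> (real \<Rightarrow> 'a) \<Rightarrow> (real \<Rightarrow> real) \<Rightarrow> bool" where
  "SDD_solution f G \<mu> \<eta>t h t0 g \<eta>0 y \<eta> \<longleftrightarrow>
     continuous_on {t0 - h..} y \<and> continuous_on {t0..} \<eta> \<and>
     (\<forall>t\<in>{t0 - h..t0}. y t = g t) \<and> \<eta> t0 = \<eta>0 \<and>
     C1_on {t0..} y \<and> C1_on {t0..} \<eta> \<and>
     (\<forall>t>t0. (y has_vector_derivative f (t, y t, y (t - \<eta> t))) (at t)) \<and>
     (\<forall>t>t0. (\<eta> has_real_derivative - \<mu> * (\<eta> t - \<eta>t) + G (y t)) (at t))"

definition admissible_initial_time ::
  "real \<Rightarrow> real \<Rightarrow> real \<Rightarrow> real \<Rightarrow> (real \<Rightarrow> real) \<Rightarrow> bool" where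
  "admissible_initial_time h t0 s0 \<eta>0 \<omega> \<longleftrightarrow>
     C1_on {s0 - h..s0} \<omega> \<and> (\<forall>s\<in>{s0 - h..s0}. deriv_on {s0 - h..s0} \<omega> s > 0) \<and>
     \<omega> s0 = t0 \<and> \<omega> (s0 - h) = t0 - \<eta>0 \<and> t0 - \<eta>0 < t0"

text \<open>\<open>\<sigma>\<close> is a function on \<open>[t0,\<infinity>)\<close>, hence the inverse is taken there. At \<open>s = s0\<close> the two
  prescriptions agree when \<open>\<omega> s0 = t0\<close> and \<open>\<sigma> t0 = \<omega> (s0 - h)\<close>. Values for \<open>s < s0 - h\<close> are
  irrelevant; the test \<open>h \<le> 0\<close> only serves termination.\<close>

function time_transformation ::
  "real \<Rightarrow> real \<Rightarrow> real \<Rightarrow> (real \<Rightarrow> real) \<Rightarrow> (real \<Rightarrow> real) \<Rightarrow> real \<Rightarrow> real" where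
  "time_transformation h t0 s0 \<sigma> \<omega> s =
     (if s \<le> s0 \<or> h \<le> 0 then \<omega> s
      else inv_into {t0..} \<sigma> (time_transformation h t0 s0 \<sigma> \<omega> (s - h)))"
  by pat_completeness auto
termination
proof (relation "Wellfounded.measure (\<lambda>(h, t0, s0, \<sigma>, \<omega>, s). nat \<lceil>(s - s0) / h\<rceil>)", goal_cases)
  case (2 h t0 s0 \<sigma> \<omega> s)
  then have "(s - h - s0) / h = (s - s0) / h - 1" "(s - s0) / h > 0"
    by (auto simp: field_simps)
  then have "\<lceil>(s - h - s0) / h\<rceil> = \<lceil>(s - s0) / h\<rceil> - 1" "\<lceil>(s - s0) / h\<rceil> > 0"
    by simp_all
  then show ?case by simp
qed simp

declare time_transformation.simps [simp del]

end

theory Submission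
  imports Defs "HOL-Complex_Analysis.Great_Picard"
begin

text \<open>By Arzela--Ascoli, the segments of a function on a half-line form a precompact family in \<open>C\<close>
  exactly when the function is, far enough out, bounded and uniformly continuous; for \<open>C\<^sup>1\<close> the same
  holds for the function together with its derivative. These properties pass from \<open>y\<close> to
  \<open>z = y \<circ> \<alpha>\<close> and, since \<open>y = z \<circ> \<alpha>\<^sup>-\<^sup>1\<close>, back. For the converse direction one needs that \<open>\<alpha>\<close> is onto
  a half-line and that \<open>\<alpha>\<^sup>-\<^sup>1\<close> tends to infinity; both follow from the continuity of \<open>\<alpha>\<close>, which rests
  on the strict monotonicity of the deviating argument.\<close>

section \<open>Precompactness in metric spaces\<close>

text \<open>Both directions are instances of one statement about \<open>w s = u (\<phi> s)\<close>
  with \<open>\<phi>\<close> tending to infinity, because \<open>u\<close> is controlled only on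
  some half-line and \<open>\<phi>\<close> must end up there. Two obstacles shape the
  \<open>C\<^sup>1\<close> case. The derivatives that a segment provides are taken within
  \<open>{-h..0}\<close>, hence one-sided at its ends, whereas the chain rule wants two-sided ones;
  so every point is read off in the interior of some segment, and thresholds are passed strictly.
  Moreover the derivative of \<open>w\<close> is a product, and uniform continuity passes to
  products when both factors are bounded. The bound in norm for the derivative of
  \<open>\<phi>\<close> is drawn from the uniform continuity of \<open>\<phi>\<close> and of its
  derivative: over a short step of fixed length the increment of \<open>\<phi>\<close> is small and
  nearly linear. On the side of the delay system, the invariance of the interval from 0 to
  \<open>2 * \<eta>t\<close> under the delay equation yields both that the deviating argument
  increases strictly and that it tends to infinity.\<close>

lemma (in Metric_space) compactin_closure_of_sequentiallyI:
  assumes "\<And>x :: nat \<Rightarrow> 'a. range x \<subseteq> S \<Longrightarrow>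
             \<exists>l r. l \<in> M \<and> strict_mono (r :: nat \<Rightarrow> nat) \<and>
                (\<forall>e>0. \<exists>N. \<forall>n\<ge>N. d l (x (r n)) < e)"
    and "S \<subseteq> M"
  shows "compactin mtopology (mtopology closure_of S)"
  unfolding compact_closure_of_eq_Bolzano_Weierstrass
proof (intro allI impI, elim conjE)
  fix T assume T: "infinite T" "T \<subseteq> S"
  obtain x :: "nat \<Rightarrow> 'a" where x: "inj x" "range x \<subseteq> T"
    using infinite_countable_subset[OF T(1)] by blast
  then obtain l r where l: "l \<in> M" and r: "strict_mono (r :: nat \<Rightarrow> nat)"
    and lim: "\<forall>e>0. \<exists>N. \<forall>n\<ge>N. d l (x (r n)) < e"
    using assms(1)[of x] T(2) by blast
  have "infinite (T \<inter> mball l e)" if "e > 0" for e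
  proof -
    obtain N where N: "\<And>n. n \<ge> N \<Longrightarrow> d l (x (r n)) < e"
      using lim \<open>e > 0\<close> by blast
    have "(\<lambda>n. x (r n)) ` {N..} \<subseteq> T \<inter> mball l e"
      using x(2) T(2) assms(2) l N by (force simp: in_mball)
    \<comment> \<open>A limit point needs infinitely many distinct points in each ball; injectivity
      keeps the tail of the subsequence from collapsing to finitely many values.\<close>
    moreover have "inj (\<lambda>n. x (r n))"
      using inj_compose[OF x(1) strict_mono_imp_inj_on[OF r]] by (simp add: o_def)
    then have "infinite ((\<lambda>n. x (r n)) ` {N..})"
      by (meson finite_imageD infinite_Ici inj_on_subset subset_UNIV)
    ultimately show ?thesis
      using finite_subset by blast
  qed
  then show "mtopology derived_set_of T \<noteq> {}"
    unfolding derived_set_of_infinite_mball using l by blast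
qed

lemma precompact_inI:
  assumes "\<And>x :: nat \<Rightarrow> 'a. range x \<subseteq> P \<Longrightarrow>
             \<exists>l r. l \<in> mspace m \<and> strict_mono (r :: nat \<Rightarrow> nat) \<and>
                (\<forall>e>0. \<exists>N. \<forall>n\<ge>N. mdist m l (x (r n)) < e)"
    and "P \<subseteq> mspace m"
  shows "precompact_in m P"
  unfolding precompact_in_def mtopology_of_def
  using assms Metric_space.compactin_closure_of_sequentiallyI[OF Metric_space_mspace_mdist, of P m]
  by blast

text \<open>Total boundedness is the form in which compactness enters when properties of a function
  are deduced from its segments.\<close>

lemma precompact_in_finite_net:
  assumes "precompact_in m P" "0 < e"
  obtains K where "finite K" "K \<subseteq> mspace m" "\<And>u. u \<in> P \<Longrightarrow> \<exists>k\<in>K. mdist m k u < e"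
proof -
  interpret Metric_space "mspace m" "mdist m" by simp
  have P: "compactin mtopology (mtopology closure_of P)" "P \<subseteq> mspace m"
    using assms(1) by (simp_all add: precompact_in_def mtopology_of_def)
  obtain K where K: "finite K" "K \<subseteq> P" "P \<subseteq> (\<Union>x\<in>K. mball x e)"
    using compact_closure_of_imp_mtotally_bounded[OF P, unfolded mtotally_bounded_def, rule_format, OF assms(2)]
    by (elim exE conjE)
  have "\<exists>k\<in>K. mdist m k u < e" if u: "u \<in> P" for u
  proof -
    obtain k where "k \<in> K" "u \<in> mball k e"
      using subsetD[OF K(3) u] by (elim UN_E)
    then show ?thesis
      by (intro bexI[of _ k]) (simp_all add: in_mball)
  qed
  with K(1) order.trans[OF K(2) P(2)] show ?thesis
    by (rule that)
qed

section \<open>Precompact families of segments\<close>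

lemma restrict_in_C_space:
  assumes "continuous_on {a..b} u"
  shows "restrict u {a..b} \<in> C_space a b"
proof -
  have "continuous_on {a..b} (restrict u {a..b})"
    using assms by (subst continuous_on_cong[OF refl, where g = u]) auto
  then show ?thesis
    by (simp add: C_space_def)
qed

text \<open>Used to treat a function and its derivative as one function, so that a single
  subsequence serves both, and to view a product as multiplication after a uniformly continuous
  map.\<close>

lemma uniformly_continuous_on_Pair:
  fixes u :: "'a::metric_space \<Rightarrow> 'b::metric_space" and v :: "'a \<Rightarrow> 'c::metric_space"
  assumes "uniformly_continuous_on S u" "uniformly_continuous_on S v"
  shows "uniformly_continuous_on S (\<lambda>x. (u x, v x))"
  unfolding uniformly_continuous_on_def
proof (intro allI impI)
  fix e :: real assume "e > 0"
  then have e: "e / 2 > 0" by simp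
  obtain d1 d2 where d: "d1 > 0" "d2 > 0"
    "\<And>x x'. x \<in> S \<Longrightarrow> x' \<in> S \<Longrightarrow> dist x' x < d1 \<Longrightarrow> dist (u x') (u x) < e / 2"
    "\<And>x x'. x \<in> S \<Longrightarrow> x' \<in> S \<Longrightarrow> dist x' x < d2 \<Longrightarrow> dist (v x') (v x) < e / 2"
    using assms e unfolding uniformly_continuous_on_def by metis
  have "dist (u x', v x') (u x, v x) < e"
    if "x \<in> S" "x' \<in> S" "dist x' x < min d1 d2" for x x'
    using d(3,4)[of x x'] that sqrt_sum_squares_le_sum[of "dist (u x') (u x)" "dist (v x') (v x)"]
    by (simp add: dist_Pair_Pair)
  then show "\<exists>d>0. \<forall>x\<in>S. \<forall>x'\<in>S. dist x' x < d \<longrightarrow> dist (u x', v x') (u x, v x) < e"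
    using d(1,2) by (intro exI[of _ "min d1 d2"]) auto
qed

lemma uniformly_continuous_on_compose_map:
  fixes \<phi> :: "'a::metric_space \<Rightarrow> 'b::metric_space" and u :: "'b \<Rightarrow> 'c::metric_space"
  assumes "uniformly_continuous_on S \<phi>" "uniformly_continuous_on T u" "\<phi> ` S \<subseteq> T"
  shows "uniformly_continuous_on S (\<lambda>x. u (\<phi> x))"
proof -
  have "uniformly_continuous_on (\<phi> ` S) u"
    using assms(2,3) unfolding uniformly_continuous_on_def by (meson subsetD)
  then show ?thesis
    by (rule uniformly_continuous_on_compose[OF assms(1)])
qed

section \<open>From finite nets of segments to boundedness and uniform continuity\<close>

lemma uniformly_close_shifts_imp_bounded:
  fixes u :: "real \<Rightarrow> 'a::real_normed_vector"
  assumes h: "0 < h"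
    and K: "finite K" "K \<subseteq> C_space (-h) 0"
    and net: "\<And>t. t \<ge> t1 \<Longrightarrow> \<exists>k\<in>K. \<forall>\<theta>\<in>{-h..0}. norm (u (t + \<theta>) - k \<theta>) < e"
  shows "bounded (u ` {t1 - h..})"
proof -
  have "bounded (\<Union>k\<in>K. k ` {-h..0})"
    using K by (intro bounded_UN ballI compact_imp_bounded compact_continuous_image)
      (auto simp: C_space_def)
  then obtain B where B: "\<And>k \<theta>. k \<in> K \<Longrightarrow> \<theta> \<in> {-h..0} \<Longrightarrow> norm (k \<theta>) \<le> B"
    unfolding bounded_iff by blast
  have "norm (u x) \<le> B + e" if x: "x \<ge> t1 - h" for x
  proof -
    \<comment> \<open>The point \<open>x\<close> is the left end of the segment at
      \<open>x + h\<close>, and \<open>x + h \<ge> t1\<close> holds exactly when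
      \<open>x \<ge> t1 - h\<close>.\<close>
    obtain k where k: "k \<in> K" "\<forall>\<theta>\<in>{-h..0}. norm (u (x + h + \<theta>) - k \<theta>) < e"
      using net[of "x + h"] x by auto
    have "norm (u x - k (-h)) < e"
      using bspec[OF k(2), of "-h"] h by simp
    then show ?thesis
      using B[OF k(1), of "-h"] h norm_triangle_sub[of "u x" "k (-h)"] by auto
  qed
  then show ?thesis
    unfolding bounded_iff by (metis atLeast_iff imageE)
qed

text \<open>Finitely many continuous functions on a compact interval share a modulus of continuity,
  and every segment inherits it up to the error of the net. Phrasing the hypothesis by shifts and
  not by a distance makes the lemma applicable to a derivative as well.\<close>

lemma uniformly_close_shifts_imp_uniformly_continuous:
  fixes u :: "real \<Rightarrow> 'a::real_normed_vector"
  assumes h: "0 < h"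
    and net: "\<And>e. e > 0 \<Longrightarrow> \<exists>K. finite K \<and> K \<subseteq> C_space (-h) 0 \<and>
               (\<forall>t\<ge>t1. \<exists>k\<in>K. \<forall>\<theta>\<in>{-h..0}. norm (u (t + \<theta>) - k \<theta>) < e)"
  shows "uniformly_continuous_on {t1 - h..} u"
  unfolding uniformly_continuous_on_def
proof (intro allI impI)
  fix e :: real assume "e > 0"
  then obtain K where K: "finite K" "K \<subseteq> C_space (-h) 0"
    and close: "\<And>t. t \<ge> t1 \<Longrightarrow> \<exists>k\<in>K. \<forall>\<theta>\<in>{-h..0}. norm (u (t + \<theta>) - k \<theta>) < e / 3"
    using net[of "e / 3"] by auto
  have "\<exists>d>0. \<forall>\<theta>\<in>{-h..0}. \<forall>\<theta>'\<in>{-h..0}. dist \<theta>' \<theta> < d \<longrightarrow> dist (k \<theta>') (k \<theta>) < e / 3"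
    if "k \<in> K" for k
  proof -
    have uc: "uniformly_continuous_on {-h..0} k"
      using K(2) that by (intro compact_uniformly_continuous) (auto simp: C_space_def)
    show ?thesis
      by (rule mp[OF spec[OF uc[unfolded uniformly_continuous_on_def], of "e / 3"]])
        (use \<open>e > 0\<close> in simp)
  qed
  then obtain d where d: "\<And>k. k \<in> K \<Longrightarrow> d k > 0"
    and ucd: "\<And>k \<theta> \<theta>'. k \<in> K \<Longrightarrow> \<theta> \<in> {-h..0} \<Longrightarrow> \<theta>' \<in> {-h..0} \<Longrightarrow> dist \<theta>' \<theta> < d k \<Longrightarrow>
                dist (k \<theta>') (k \<theta>) < e / 3"
    by metis
  \<comment> \<open>Including \<open>h\<close> ensures that two points closer than
    \<open>\<delta>\<close> fit into one segment.\<close>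
  define \<delta> where "\<delta> = Min (insert h (d ` K))"
  have \<delta>: "\<delta> > 0" "\<delta> \<le> h" "\<And>k. k \<in> K \<Longrightarrow> \<delta> \<le> d k"
    unfolding \<delta>_def using K(1) d h by auto
  have "dist (u x') (u x) < e" if x: "x \<ge> t1 - h" "x' \<ge> t1 - h" "dist x' x < \<delta>" for x x'
  proof -
    \<comment> \<open>The smallest admissible right end of a segment that contains both
      points.\<close>
    define t where "t = max t1 (max x x')"
    have th: "x - t \<in> {-h..0}" "x' - t \<in> {-h..0}" "t \<ge> t1"
      using x \<delta>(2) by (auto simp: t_def dist_real_def)
    obtain k where k: "k \<in> K" "\<forall>\<theta>\<in>{-h..0}. norm (u (t + \<theta>) - k \<theta>) < e / 3"
      using close th(3) by blast
    have "dist (k (x' - t)) (k (x - t)) < e / 3"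
      using ucd[OF k(1) th(1,2)] x(3) \<delta>(3)[OF k(1)] by (simp add: dist_real_def)
    moreover have "dist (k (x - t)) (u x) < e / 3" "dist (u x') (k (x' - t)) < e / 3"
      using bspec[OF k(2) th(1)] bspec[OF k(2) th(2)] by (simp_all add: dist_norm norm_minus_commute)
    ultimately show ?thesis
      using dist_triangle_third by blast
  qed
  then show "\<exists>d>0. \<forall>x\<in>{t1 - h..}. \<forall>x'\<in>{t1 - h..}. dist x' x < d \<longrightarrow> dist (u x') (u x) < e"
    using \<delta>(1) by auto
qed

lemma precompact_C_segments_imp:
  fixes u :: "real \<Rightarrow> 'a::real_normed_vector"
  assumes h: "0 < h" and P: "precompact_in (C_metric (-h) 0) P" "segment h u ` {t1..} \<subseteq> P"
  shows "bounded (u ` {t1 - h..})" "uniformly_continuous_on {t1 - h..} u"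
proof -
  have net: "\<exists>K. finite K \<and> K \<subseteq> C_space (-h) 0 \<and>
               (\<forall>t\<ge>t1. \<exists>k\<in>K. \<forall>\<theta>\<in>{-h..0}. norm (u (t + \<theta>) - k \<theta>) < e)" if e: "e > 0" for e
  proof -
    obtain K where K: "finite K" "K \<subseteq> C_space (-h) 0"
      "\<And>v. v \<in> P \<Longrightarrow> \<exists>k\<in>K. C_dist (-h) 0 k v < e"
      using precompact_in_finite_net[OF P(1) e] h by auto
    have "\<exists>k\<in>K. \<forall>\<theta>\<in>{-h..0}. norm (u (t + \<theta>) - k \<theta>) < e" if "t \<ge> t1" for t
    proof -
      have tP: "segment h u t \<in> P" using P(2) that by auto
      then obtain k where k: "k \<in> K" "C_dist (-h) 0 k (segment h u t) < e" using K(3) by blast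
      moreover have "segment h u t \<in> C_space (-h) 0"
        using P(1) tP h by (auto simp: precompact_in_def)
      ultimately show ?thesis
        using C_dist_upper[of k "-h" 0 "segment h u t"] K(2)
        by (intro bexI[of _ k]) (force simp: segment_def norm_minus_commute)+
    qed
    then show ?thesis using K by blast
  qed
  show "uniformly_continuous_on {t1 - h..} u"
    by (rule uniformly_close_shifts_imp_uniformly_continuous[OF h net])
  show "bounded (u ` {t1 - h..})"
    using net[of 1] uniformly_close_shifts_imp_bounded[OF h, of _ t1 u 1] by auto
qed

section \<open>Derivatives of a function and of its segments\<close>

lemma deriv_on_Icc_eqI:
  assumes "a < b" "x \<in> {a..b}" "(u has_vector_derivative D) (at x within {a..b})"
  shows "deriv_on {a..b} u x = D"
  unfolding deriv_on_def
  using assms by (intro vector_derivative_within) (auto simp: trivial_limit_within islimpt_Icc)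

lemma segment_has_vector_derivative:
  assumes "(u has_vector_derivative D) (at (t + \<theta>))" "\<theta> \<in> {-h..0}"
  shows "(segment h u t has_vector_derivative D) (at \<theta> within {-h..0})"
proof -
  have "((\<lambda>\<theta>. t + \<theta>) has_vector_derivative 1) (at \<theta>)"
    by (auto intro!: derivative_eq_intros)
  from vector_diff_chain_at[OF this] assms(1)
  have "((\<lambda>\<theta>. u (t + \<theta>)) has_vector_derivative D) (at \<theta>)"
    by (simp add: o_def)
  then show ?thesis
    by (intro has_vector_derivative_transform[OF assms(2) _ has_vector_derivative_at_within])
      (auto simp: segment_def)
qed

text \<open>At an end of the interval the segment sees \<open>u\<close> from one side only, hence
  the open range for \<theta>. Naming the derivative by \<open>vector_derivative u\<close> makes it
  independent of the segment from which it is read off.\<close>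

lemma C1_segment_imp_has_vector_derivative:
  assumes "segment h u t \<in> C1_space (-h) 0" "-h < \<theta>" "\<theta> < 0"
  shows "(u has_vector_derivative vector_derivative u (at (t + \<theta>))) (at (t + \<theta>))"
proof -
  obtain D where "(segment h u t has_vector_derivative D) (at \<theta> within {-h..0})"
    using assms unfolding C1_space_def C1_on_def by fastforce
  then have "(segment h u t has_vector_derivative D) (at \<theta>)"
    using assms(2,3) by (subst (asm) at_within_interior) auto
  then have "((\<lambda>\<theta>. u (t + \<theta>)) has_vector_derivative D) (at \<theta>)"
    by (rule has_vector_derivative_transform_within_open[of _ _ _ "{-h<..<0}"])
      (use assms in \<open>auto simp: segment_def\<close>)
  moreover have "((\<lambda>x. x - t) has_vector_derivative 1) (at (t + \<theta>))"
    by (auto intro!: derivative_eq_intros)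
  ultimately have "((\<lambda>\<theta>. u (t + \<theta>)) \<circ> (\<lambda>x. x - t) has_vector_derivative 1 *\<^sub>R D) (at (t + \<theta>))"
    by (intro vector_diff_chain_at) auto
  then have u: "(u has_vector_derivative D) (at (t + \<theta>))"
    by (simp add: o_def)
  then show ?thesis
    by (simp add: vector_derivative_at[OF u])
qed

lemma precompact_C1_segments_imp:
  fixes u :: "real \<Rightarrow> 'a::real_normed_vector"
  assumes h: "0 < h" and P: "precompact_in (C1_metric (-h) 0) P" "segment h u ` {t1..} \<subseteq> P"
  obtains D where "\<And>x. x \<ge> t1 \<Longrightarrow> (u has_vector_derivative D x) (at x)"
    "bounded (u ` {t1..})" "uniformly_continuous_on {t1..} u"
    "bounded (D ` {t1..})" "uniformly_continuous_on {t1..} D"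
proof -
  define D where "D x = vector_derivative u (at x)" for x
  have C1: "segment h u t \<in> C1_space (-h) 0" if "t \<ge> t1" for t
    using P h that by (auto simp: precompact_in_def)
  \<comment> \<open>The point \<open>x\<close> is the midpoint of the segment at
    \<open>x + h / 2\<close>, so it is interior.\<close>
  have D: "(u has_vector_derivative D x) (at x)" if "x \<ge> t1" for x
    using C1_segment_imp_has_vector_derivative[OF C1, of "x + h / 2" "- (h / 2)"] that h
    by (simp add: D_def)
  \<comment> \<open>From \<open>t1 + h\<close> on, a whole segment lies in the half-line from
    \<open>t1\<close>, where the two-sided derivative \<open>D\<close> has been established.\<close>
  have net: "\<exists>K. finite K \<and> K \<subseteq> C1_space (-h) 0 \<and>
               (\<forall>t\<ge>t1+h. \<exists>k\<in>K. C1_dist (-h) 0 k (segment h u t) < e)" if e: "e > 0" for e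
  proof -
    obtain K where "finite K" "K \<subseteq> C1_space (-h) 0"
      "\<And>v. v \<in> P \<Longrightarrow> \<exists>k\<in>K. C1_dist (-h) 0 k v < e"
      using precompact_in_finite_net[OF P(1) e] h by auto
    then show ?thesis using P(2) h by (intro exI[of _ K]) (auto simp: image_subset_iff)
  qed
  let ?d = "\<lambda>k :: real \<Rightarrow> 'a. restrict (deriv_on {-h..0} k) {-h..0}"
  \<comment> \<open>\<open>C1_dist\<close> is a sum of two nonnegative distances and dominates each.
    A net \<open>K\<close> for the segments is thus a net for \<open>u\<close>, and its image under
    \<open>?d\<close> is one for \<open>D\<close>.\<close>
  have close: "norm (u (t + \<theta>) - k \<theta>) \<le> C1_dist (-h) 0 k (segment h u t)"
    "norm (D (t + \<theta>) - ?d k \<theta>) \<le> C1_dist (-h) 0 k (segment h u t)"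
    if "t \<ge> t1 + h" "k \<in> C1_space (-h) 0" "\<theta> \<in> {-h..0}" for k t \<theta>
  proof -
    interpret C: Metric_space "C_space (-h) 0 :: (real \<Rightarrow> 'a) set" "C_dist (-h) 0"
      using h by (intro Metric_space_C) auto
    have seg: "segment h u t \<in> C1_space (-h) 0" using C1 that h by auto
    note mem = subsetD[OF C1_space_subset] deriv_on_in_C_space[of "-h" 0]
    have "norm (k \<theta> - segment h u t \<theta>) \<le> C_dist (-h) 0 k (segment h u t)"
      using that seg mem by (intro C_dist_upper) auto
    moreover have "?d (segment h u t) \<theta> = D (t + \<theta>)"
      using that h
      by (simp add: deriv_on_Icc_eqI[OF _ _ segment_has_vector_derivative[OF D]])
    moreover have "norm (?d k \<theta> - ?d (segment h u t) \<theta>) \<le> C_dist (-h) 0 (?d k) (?d (segment h u t))"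
      by (rule C_dist_upper[OF mem(2)[OF _ that(2)] mem(2)[OF _ seg] that(3)]) (use h in auto)
    ultimately show "norm (u (t + \<theta>) - k \<theta>) \<le> C1_dist (-h) 0 k (segment h u t)"
      "norm (D (t + \<theta>) - ?d k \<theta>) \<le> C1_dist (-h) 0 k (segment h u t)"
      using that(3) add_increasing2[OF C.nonneg[of "?d k" "?d (segment h u t)"]]
        add_increasing[OF C.nonneg[of k "segment h u t"]]
      unfolding C1_dist_def by (simp_all add: segment_def norm_minus_commute)
  qed
  have net_u: "\<exists>K. finite K \<and> K \<subseteq> C_space (-h) 0 \<and>
               (\<forall>t\<ge>t1+h. \<exists>k\<in>K. \<forall>\<theta>\<in>{-h..0}. norm (u (t + \<theta>) - k \<theta>) < e)" if e: "e > 0" for e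
  proof -
    obtain K where K: "finite K" "K \<subseteq> C1_space (-h) 0"
      "\<forall>t\<ge>t1+h. \<exists>k\<in>K. C1_dist (-h) 0 k (segment h u t) < e"
      using net[OF e] by (elim exE conjE)
    have "\<exists>k\<in>K. \<forall>\<theta>\<in>{-h..0}. norm (u (t + \<theta>) - k \<theta>) < e" if t: "t \<ge> t1 + h" for t
    proof -
      obtain k where k: "k \<in> K" "C1_dist (-h) 0 k (segment h u t) < e"
        using K(3)[rule_format, OF t] by (elim bexE)
      have "norm (u (t + \<theta>) - k \<theta>) < e" if "\<theta> \<in> {-h..0}" for \<theta>
        using le_less_trans[OF close(1)[OF t subsetD[OF K(2) k(1)] that] k(2)] .
      then show ?thesis using k(1) by (intro bexI[of _ "k"] ballI) auto
    qed
    then show ?thesis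
      using K(1) order.trans[OF K(2) C1_space_subset] by (intro exI[of _ K] conjI allI impI)
  qed
  have net_D: "\<exists>K. finite K \<and> K \<subseteq> C_space (-h) 0 \<and>
               (\<forall>t\<ge>t1+h. \<exists>k\<in>K. \<forall>\<theta>\<in>{-h..0}. norm (D (t + \<theta>) - k \<theta>) < e)" if e: "e > 0" for e
  proof -
    obtain K where K: "finite K" "K \<subseteq> C1_space (-h) 0"
      "\<forall>t\<ge>t1+h. \<exists>k\<in>K. C1_dist (-h) 0 k (segment h u t) < e"
      using net[OF e] by (elim exE conjE)
    have "\<exists>k\<in>?d ` K. \<forall>\<theta>\<in>{-h..0}. norm (D (t + \<theta>) - k \<theta>) < e" if t: "t \<ge> t1 + h" for t
    proof -
      obtain k where k: "k \<in> K" "C1_dist (-h) 0 k (segment h u t) < e"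
        using K(3)[rule_format, OF t] by (elim bexE)
      have "norm (D (t + \<theta>) - ?d k \<theta>) < e" if "\<theta> \<in> {-h..0}" for \<theta>
        using le_less_trans[OF close(2)[OF t subsetD[OF K(2) k(1)] that] k(2)] .
      then show ?thesis using k(1) by (intro bexI[of _ "?d k"] ballI) auto
    qed
    moreover have "finite (?d ` K)" "?d ` K \<subseteq> C_space (-h) 0"
      using K(1) deriv_on_in_C_space[OF _ subsetD[OF K(2)]] h by (auto simp del: restrict_apply)
    ultimately show ?thesis
      by (intro exI[of _ "?d ` K"] conjI allI impI)
  qed
  have bounded: "bounded (w ` {t1..})"
    if "\<exists>K. finite K \<and> K \<subseteq> C_space (-h) 0 \<and>
         (\<forall>t\<ge>t1+h. \<exists>k\<in>K. \<forall>\<theta>\<in>{-h..0}. norm (w (t + \<theta>) - k \<theta>) < 1)" for w :: "real \<Rightarrow> 'a"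
    using that uniformly_close_shifts_imp_bounded[OF h, of _ "t1 + h" w 1] by auto
  show ?thesis
  proof (rule that[OF D bounded[OF net_u] _ bounded[OF net_D]])
    show "uniformly_continuous_on {t1..} u"
      using uniformly_close_shifts_imp_uniformly_continuous[OF h net_u] by simp
    show "uniformly_continuous_on {t1..} D"
      using uniformly_close_shifts_imp_uniformly_continuous[OF h net_D] by simp
  qed auto
qed

section \<open>From boundedness and uniform continuity to precompact segments\<close>

lemma shifts_uniformly_convergent_subsequence:
  fixes u :: "real \<Rightarrow> 'a::euclidean_space"
  assumes "bounded (u ` {a..})" "uniformly_continuous_on {a..} u" "\<And>n :: nat. a + h \<le> t n"
  obtains v and r :: "nat \<Rightarrow> nat" where "continuous_on {-h..0} v" "strict_mono r"
    "\<forall>e>0. \<exists>N. \<forall>n\<ge>N. \<forall>\<theta>\<in>{-h..0}. norm (u (t (r n) + \<theta>) - v \<theta>) < e"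
proof -
  obtain B where B: "\<And>x. x \<ge> a \<Longrightarrow> norm (u x) \<le> B"
    using assms(1) unfolding bounded_iff by auto
  have mem: "t n + \<theta> \<ge> a" if "\<theta> \<in> {-h..0}" for n \<theta>
    using assms(3)[of n] that by simp
  note goal = that
  show ?thesis
  proof (rule Arzela_Ascoli[of "{-h..0}" "\<lambda>n \<theta>. u (t n + \<theta>)" B])
    show "norm (u (t n + \<theta>)) \<le> B" if "\<theta> \<in> {-h..0}" for n \<theta>
      using B mem[OF that] by blast
    \<comment> \<open>One \<open>d\<close> must serve all \<open>n\<close>: uniform continuity of
      \<open>u\<close> on the half-line is equicontinuity of its shifts, however far out the times
      \<open>t n\<close> lie.\<close>
    show "\<exists>d>0. \<forall>n \<theta>'. \<theta>' \<in> {-h..0} \<and> norm (\<theta> - \<theta>') < d \<longrightarrow>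
             norm (u (t n + \<theta>) - u (t n + \<theta>')) < e" if th: "\<theta> \<in> {-h..0}" and "0 < e" for \<theta> e
    proof -
      obtain d where d: "d > 0"
        "\<And>x x'. x \<ge> a \<Longrightarrow> x' \<ge> a \<Longrightarrow> dist x' x < d \<Longrightarrow> dist (u x') (u x) < e"
        using assms(2) \<open>0 < e\<close> unfolding uniformly_continuous_on_def by fastforce
      have "norm (u (t n + \<theta>) - u (t n + \<theta>')) < e"
        if "\<theta>' \<in> {-h..0}" "norm (\<theta> - \<theta>') < d" for n \<theta>'
        using d(2)[OF mem[OF that(1)] mem[OF th], of n n] that(2) by (simp add: dist_norm)
      then show ?thesis using d(1) by blast
    qed
    show thesis if "continuous_on {-h..0} v" "strict_mono r"
      "\<And>e. 0 < e \<Longrightarrow> \<exists>N. \<forall>n \<theta>. n \<ge> N \<and> \<theta> \<in> {-h..0} \<longrightarrow> norm (u (t (r n) + \<theta>) - v \<theta>) < e"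
      for v and r :: "nat \<Rightarrow> nat"
      using that(3) by (intro goal[OF that(1,2)]) blast
  qed auto
qed

lemma segment_in_C_space:
  assumes "continuous_on {a..} u" "a + h \<le> t"
  shows "segment h u t \<in> C_space (-h) 0"
proof -
  have "continuous_on {-h..0} (\<lambda>\<theta>. u (t + \<theta>))"
    using assms by (intro continuous_on_compose2[OF assms(1)] continuous_intros) auto
  then show ?thesis
    unfolding segment_def by (rule restrict_in_C_space)
qed

lemma precompact_C_segmentsI:
  fixes u :: "real \<Rightarrow> 'a::euclidean_space"
  assumes h: "0 < h" and u: "bounded (u ` {a..})" "uniformly_continuous_on {a..} u"
  shows "precompact_in (C_metric (-h) 0) (segment h u ` {a + h..})"
proof (rule precompact_inI)
  have seg: "segment h u t \<in> C_space (-h) 0" if "a + h \<le> t" for t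
    using u(2) that by (intro segment_in_C_space[of a] uniformly_continuous_imp_continuous)
  then show "segment h u ` {a + h..} \<subseteq> mspace (C_metric (-h) 0)"
    using h by auto
  fix x :: "nat \<Rightarrow> real \<Rightarrow> 'a" assume "range x \<subseteq> segment h u ` {a + h..}"
  then have "\<forall>n. \<exists>t. a + h \<le> t \<and> x n = segment h u t" by fastforce
  then obtain t where t: "\<And>n. a + h \<le> t n" and x: "\<And>n. x n = segment h u (t n)"
    by metis
  obtain v and r :: "nat \<Rightarrow> nat" where v: "continuous_on {-h..0} v" and r: "strict_mono r"
    and lim: "\<forall>e>0. \<exists>N. \<forall>n\<ge>N. \<forall>\<theta>\<in>{-h..0}. norm (u (t (r n) + \<theta>) - v \<theta>) < e"
    using shifts_uniformly_convergent_subsequence[of u a h t, OF u t] .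
  let ?v = "restrict v {-h..0}"
  have vC: "?v \<in> C_space (-h) 0"
    using v by (rule restrict_in_C_space)
  have "\<exists>N. \<forall>n\<ge>N. C_dist (-h) 0 ?v (x (r n)) < e" if e: "e > 0" for e
  proof -
    \<comment> \<open>Half of \<open>e\<close>, since a supremum of values below a bound may equal
      the bound.\<close>
    obtain N where N: "\<forall>n\<ge>N. \<forall>\<theta>\<in>{-h..0}. norm (u (t (r n) + \<theta>) - v \<theta>) < e / 2"
      using lim half_gt_zero[OF e] by blast
    have "C_dist (-h) 0 ?v (x (r n)) \<le> e / 2" if "n \<ge> N" for n
    proof (rule C_dist_least)
      show "norm (?v \<theta> - x (r n) \<theta>) \<le> e / 2" if "\<theta> \<in> {-h..0}" for \<theta>
        using N[rule_format, OF \<open>n \<ge> N\<close> that] that by (simp add: x segment_def norm_minus_commute)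
    qed (use h seg t vC in \<open>auto simp: x\<close>)
    then show ?thesis using e by (intro exI[of _ N]) force
  qed
  then show "\<exists>l r. l \<in> mspace (C_metric (-h) 0) \<and> strict_mono (r :: nat \<Rightarrow> nat) \<and>
                (\<forall>e>0. \<exists>N. \<forall>n\<ge>N. mdist (C_metric (-h) 0) l (x (r n)) < e)"
    using vC r h by auto
qed

text \<open>Needed to recognise the second component of an Arzela-Ascoli limit as the derivative of
  the first. Differentiating the sequence yields some limit \<open>g\<close>; uniqueness of
  pointwise limits identifies it with the given \<open>v\<close> on \<open>S\<close>.\<close>

lemma has_vector_derivative_uniform_limit:
  fixes F :: "nat \<Rightarrow> real \<Rightarrow> 'a::banach"
  assumes S: "convex S"
    and F: "\<And>n x. x \<in> S \<Longrightarrow> (F n has_vector_derivative F' n x) (at x within S)"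
    and lim: "\<And>x. x \<in> S \<Longrightarrow> (\<lambda>n. F n x) \<longlonglongrightarrow> v x"
    and unif: "\<And>e. e > 0 \<Longrightarrow> \<forall>\<^sub>F n in sequentially. \<forall>x\<in>S. norm (F' n x - w x) \<le> e"
    and x: "x \<in> S"
  shows "(v has_vector_derivative w x) (at x within S)"
proof -
  have "\<exists>g. \<forall>x\<in>S. (\<lambda>n. F n x) \<longlonglongrightarrow> g x \<and> (g has_derivative (\<lambda>h. h *\<^sub>R w x)) (at x within S)"
  proof (rule has_derivative_sequence[OF S, of F "\<lambda>n x h. h *\<^sub>R F' n x"])
    show "\<forall>\<^sub>F n in sequentially. \<forall>x\<in>S. \<forall>h. norm (h *\<^sub>R F' n x - h *\<^sub>R w x) \<le> e * norm h"
      if "e > 0" for e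
      using unif[OF that]
      by eventually_elim (metis mult.commute mult_left_mono norm_ge_zero norm_scaleR real_norm_def
          scaleR_diff_right)
  qed (use F lim x in \<open>auto simp: has_vector_derivative_def\<close>)
  then obtain g where g: "\<And>x. x \<in> S \<Longrightarrow> (\<lambda>n. F n x) \<longlonglongrightarrow> g x"
    "\<And>x. x \<in> S \<Longrightarrow> (g has_vector_derivative w x) (at x within S)"
    by (auto simp: has_vector_derivative_def)
  have "g x = v x" if "x \<in> S" for x
    using g(1) lim LIMSEQ_unique that by blast
  then show ?thesis
    using has_vector_derivative_transform[OF x _ g(2)[OF x], of v] by metis
qed

lemma precompact_C1_segmentsI:
  fixes u D :: "real \<Rightarrow> 'a::euclidean_space"
  assumes h: "0 < h" and D: "\<And>x. x \<ge> a \<Longrightarrow> (u has_vector_derivative D x) (at x)"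
    and u: "bounded (u ` {a..})" "uniformly_continuous_on {a..} u"
    and D_bd: "bounded (D ` {a..})" "uniformly_continuous_on {a..} D"
  shows "precompact_in (C1_metric (-h) 0) (segment h u ` {a + h..})"
proof (rule precompact_inI)
  have segD: "(segment h u t has_vector_derivative segment h D t \<theta>) (at \<theta> within {-h..0})"
    if "a + h \<le> t" "\<theta> \<in> {-h..0}" for t \<theta>
    using D[of "t + \<theta>"] that segment_has_vector_derivative[of u "D (t + \<theta>)" t \<theta> h]
    by (simp add: segment_def)
  have segDC: "segment h D t \<in> C_space (-h) 0" if "a + h \<le> t" for t
    using D_bd(2) that by (intro segment_in_C_space[of a] uniformly_continuous_imp_continuous)
  have seg: "segment h u t \<in> C1_space (-h) 0" if "a + h \<le> t" for t
    using segD[OF that] segDC[OF that] unfolding C1_space_def C1_on_def C_space_def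
    by (intro CollectI conjI exI[of _ "segment h D t"]) (auto simp: segment_def[of h u])
  then show "segment h u ` {a + h..} \<subseteq> mspace (C1_metric (-h) 0)"
    using h by auto
  fix x :: "nat \<Rightarrow> real \<Rightarrow> 'a" assume "range x \<subseteq> segment h u ` {a + h..}"
  then have "\<forall>n. \<exists>t. a + h \<le> t \<and> x n = segment h u t" by fastforce
  then obtain t where t: "\<And>n. a + h \<le> t n" and x: "\<And>n. x n = segment h u (t n)"
    by metis
  \<comment> \<open>Extracting from the pairs makes \<open>u\<close> and \<open>D\<close> converge
    along the same subsequence.\<close>
  have bd: "bounded ((\<lambda>x. (u x, D x)) ` {a..})"
    by (rule bounded_subset[OF bounded_Times[OF u(1) D_bd(1)]]) auto
  have uc: "uniformly_continuous_on {a..} (\<lambda>x. (u x, D x))"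
    using u(2) D_bd(2) by (rule uniformly_continuous_on_Pair)
  obtain p and r :: "nat \<Rightarrow> nat" where p: "continuous_on {-h..0} p" and r: "strict_mono r"
    and lim: "\<forall>e>0. \<exists>N. \<forall>n\<ge>N. \<forall>\<theta>\<in>{-h..0}.
                norm ((u (t (r n) + \<theta>), D (t (r n) + \<theta>)) - p \<theta>) < e"
    using shifts_uniformly_convergent_subsequence[of "\<lambda>x. (u x, D x)" a h t, OF bd uc t] .
  define v where "v = restrict (\<lambda>\<theta>. fst (p \<theta>)) {-h..0}"
  define w where "w = restrict (\<lambda>\<theta>. snd (p \<theta>)) {-h..0}"
  have lim': "\<exists>N. \<forall>n\<ge>N. \<forall>\<theta>\<in>{-h..0}. norm (x (r n) \<theta> - v \<theta>) \<le> e \<and>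
                   norm (segment h D (t (r n)) \<theta> - w \<theta>) \<le> e" if "e > 0" for e
  proof -
    obtain N where N: "\<And>n \<theta>. n \<ge> N \<Longrightarrow> \<theta> \<in> {-h..0} \<Longrightarrow>
        norm ((u (t (r n) + \<theta>), D (t (r n) + \<theta>)) - p \<theta>) < e"
      using lim \<open>e > 0\<close> by blast
    show ?thesis
    proof (intro exI[of _ N] allI impI ballI)
      fix n \<theta> assume "n \<ge> N" "\<theta> \<in> {-h..0}"
      then show "norm (x (r n) \<theta> - v \<theta>) \<le> e \<and> norm (segment h D (t (r n)) \<theta> - w \<theta>) \<le> e"
        using N[of n \<theta>] norm_fst_le[of "u (t (r n) + \<theta>) - v \<theta>" "D (t (r n) + \<theta>) - w \<theta>"]
          norm_snd_le[of "D (t (r n) + \<theta>) - w \<theta>" "u (t (r n) + \<theta>) - v \<theta>"]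
        by (cases "p \<theta>") (simp add: x v_def w_def segment_def)
    qed
  qed
  have wC: "w \<in> C_space (-h) 0"
    unfolding w_def using p by (intro restrict_in_C_space continuous_intros)
  have vw: "(v has_vector_derivative w \<theta>) (at \<theta> within {-h..0})" if "\<theta> \<in> {-h..0}" for \<theta>
  proof (rule has_vector_derivative_uniform_limit[of _ "\<lambda>n. x (r n)" "\<lambda>n. segment h D (t (r n))"])
    show "(\<lambda>n. x (r n) \<theta>) \<longlonglongrightarrow> v \<theta>" if th: "\<theta> \<in> {-h..0}" for \<theta>
    proof (rule LIMSEQ_I)
      fix e :: real assume "0 < e"
      then obtain N where "\<forall>n\<ge>N. norm (x (r n) \<theta> - v \<theta>) \<le> e / 2"
        using lim'[OF half_gt_zero] th by meson
      then show "\<exists>N. \<forall>n\<ge>N. norm (x (r n) \<theta> - v \<theta>) < e"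
        using \<open>0 < e\<close> by (intro exI[of _ N]) force
    qed
    show "\<forall>\<^sub>F n in sequentially. \<forall>\<theta>\<in>{-h..0}. norm (segment h D (t (r n)) \<theta> - w \<theta>) \<le> e"
      if "e > 0" for e
      using lim'[OF that] unfolding eventually_sequentially by blast
  qed (use that segD t x in auto)
  then have vC1: "v \<in> C1_space (-h) 0"
    using wC unfolding C1_space_def C1_on_def C_space_def
    by (intro CollectI conjI exI[of _ w]) (auto simp: v_def)
  \<comment> \<open>The derivative part of \<open>C1_dist\<close> becomes the uniform distance of
    \<open>w\<close> and the segments of \<open>D\<close>, which \<open>lim'\<close>
    controls.\<close>
  have d: "restrict (deriv_on {-h..0} v) {-h..0} = w"
    "restrict (deriv_on {-h..0} (x n)) {-h..0} = segment h D (t n)" for n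
    using deriv_on_Icc_eqI[OF _ _ vw] deriv_on_Icc_eqI[OF _ _ segD[OF t]] h
    by (auto simp: fun_eq_iff w_def x segment_def restrict_def)
  have "\<exists>N. \<forall>n\<ge>N. C1_dist (-h) 0 v (x (r n)) < e" if e: "e > 0" for e
  proof -
    obtain N where N: "\<forall>n\<ge>N. \<forall>\<theta>\<in>{-h..0}. norm (x (r n) \<theta> - v \<theta>) \<le> e / 3 \<and>
                   norm (segment h D (t (r n)) \<theta> - w \<theta>) \<le> e / 3"
      using lim'[of "e / 3"] e by (metis zero_less_divide_iff zero_less_numeral)
    have "C1_dist (-h) 0 v (x (r n)) < e" if "n \<ge> N" for n
    proof -
      have "C_dist (-h) 0 v (x (r n)) \<le> e / 3"
      proof (rule C_dist_least)
        show "norm (v \<theta> - x (r n) \<theta>) \<le> e / 3" if "\<theta> \<in> {-h..0}" for \<theta>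
          using N \<open>n \<ge> N\<close> that by (metis norm_minus_commute)
      qed (use h subsetD[OF C1_space_subset seg[OF t]] subsetD[OF C1_space_subset vC1] in \<open>auto simp: x\<close>)
      moreover have "C_dist (-h) 0 w (segment h D (t (r n))) \<le> e / 3"
      proof (rule C_dist_least)
        show "norm (w \<theta> - segment h D (t (r n)) \<theta>) \<le> e / 3" if "\<theta> \<in> {-h..0}" for \<theta>
          using N \<open>n \<ge> N\<close> that by (metis norm_minus_commute)
      qed (use h segDC t wC in auto)
      ultimately show ?thesis
        using e unfolding C1_dist_def d by simp
    qed
    then show ?thesis by blast
  qed
  then show "\<exists>l r. l \<in> mspace (C1_metric (-h) 0) \<and> strict_mono (r :: nat \<Rightarrow> nat) \<and>
                (\<forall>e>0. \<exists>N. \<forall>n\<ge>N. mdist (C1_metric (-h) 0) l (x (r n)) < e)"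
    using vC1 r h by auto
qed

section \<open>Reparametrisation of time\<close>

text \<open>The roles of \<open>u\<close> and \<open>w\<close> are left open so that
  \<open>\<phi>\<close> can be the time transformation or its inverse; \<open>s0\<close> stands for
  whichever initial time bounds the new half-line.\<close>

lemma precompact_C_segments_compose:
  fixes u w :: "real \<Rightarrow> 'a::euclidean_space" and \<phi> :: "real \<Rightarrow> real"
  assumes h: "0 < h" and P: "precompact_in (C_metric (-h) 0) P" "segment h u ` {t1..} \<subseteq> P"
    and uc: "uniformly_continuous_on {c..} \<phi>" and lim: "filterlim \<phi> at_top at_top"
    and w: "\<And>s. s \<ge> b \<Longrightarrow> w s = u (\<phi> s)"
  shows "\<exists>s2\<ge>s0. \<exists>Q. precompact_in (C_metric (-h) 0) Q \<and> segment h w ` {s2..} \<subseteq> Q"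
proof -
  note u = precompact_C_segments_imp[OF h P]
  obtain a0 where a0: "\<And>s. s \<ge> a0 \<Longrightarrow> t1 - h \<le> \<phi> s"
    using lim unfolding filterlim_at_top eventually_at_top_linorder by meson
  \<comment> \<open>Beyond \<open>a\<close> the map \<open>\<phi>\<close> has reached the half-line
    where \<open>u\<close> is controlled, \<open>\<phi>\<close> is uniformly continuous and
    \<open>w\<close> is the composition.\<close>
  define a where "a = max s0 (max a0 (max b c))"
  have a: "a \<ge> s0" "a \<ge> c" "\<And>s. s \<ge> a \<Longrightarrow> t1 - h \<le> \<phi> s" "\<And>s. s \<ge> a \<Longrightarrow> w s = u (\<phi> s)"
    using a0 w by (auto simp: a_def)
  have "bounded (w ` {a..})"
    by (rule bounded_subset[OF u(1)]) (use a(3,4) in auto)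
  moreover have "uniformly_continuous_on {a..} \<phi>"
    using uc a(2) unfolding uniformly_continuous_on_def by (meson atLeast_iff order.trans)
  then have "uniformly_continuous_on {a..} (\<lambda>s. u (\<phi> s))"
    by (rule uniformly_continuous_on_compose_map[OF _ u(2)]) (use a(3) in auto)
  then have "uniformly_continuous_on {a..} w"
    using a(4) unfolding uniformly_continuous_on_def by simp
  ultimately have "precompact_in (C_metric (-h) 0) (segment h w ` {a + h..})"
    by (rule precompact_C_segmentsI[OF h])
  then show ?thesis
    using a(1) h by (intro exI[of _ "a + h"] conjI exI[of _ "segment h w ` {a + h..}"]) auto
qed

text \<open>Over a step \<open>d\<close> on which \<open>\<phi>\<close> and \<open>D\<close> vary by
  at most 1, the increment of \<open>\<phi>\<close> differs from \<open>d\<close> times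
  \<open>D x\<close> by at most \<open>d\<close>; hence \<open>d * norm (D x) \<le> 1 + d\<close>.
  Only increments of \<open>\<phi>\<close> enter, so \<open>\<phi>\<close> itself may be
  unbounded.\<close>

lemma uniformly_continuous_derivative_bounded:
  fixes \<phi> :: "real \<Rightarrow> 'a::real_normed_vector"
  assumes D: "\<And>x. x \<ge> c \<Longrightarrow> (\<phi> has_vector_derivative D x) (at x within {c..})"
    and uc: "uniformly_continuous_on {c..} \<phi>" "uniformly_continuous_on {c..} D"
  shows "bounded (D ` {c..})"
proof -
  obtain d1 d2 where d12: "d1 > 0" "d2 > 0"
    "\<And>x x'. x \<ge> c \<Longrightarrow> x' \<ge> c \<Longrightarrow> dist x' x < d1 \<Longrightarrow> dist (\<phi> x') (\<phi> x) < 1"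
    "\<And>x x'. x \<ge> c \<Longrightarrow> x' \<ge> c \<Longrightarrow> dist x' x < d2 \<Longrightarrow> dist (D x') (D x) < 1"
    using uc unfolding uniformly_continuous_on_def by (metis atLeast_iff zero_less_one)
  \<comment> \<open>Halved because \<open>x + d\<close> is at distance exactly \<open>d\<close> from
    \<open>x\<close>, while the moduli require a strict inequality.\<close>
  define d where "d = min d1 d2 / 2"
  have d: "d > 0" "d < d1" "d < d2"
    using d12(1,2) by (auto simp: d_def min_def)
  have "norm (D x) \<le> 1 / d + 1" if x: "x \<ge> c" for x
  proof -
    have "norm (\<phi> (x + d) - \<phi> x - (x + d - x) *\<^sub>R D x) \<le> norm (x + d - x) * 1"
    proof (rule vector_differentiable_bound_linearization[where S = "{x..x+d}"])
      show "(\<phi> has_vector_derivative D s) (at s within {x..x + d})" if "s \<in> {x..x + d}" for s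
        by (rule has_vector_derivative_within_subset[OF D]) (use that x in auto)
      show "norm (D s - D x) \<le> 1" if "s \<in> {x..x + d}" for s
        using d12(4)[of x s] that x d by (auto simp: dist_norm less_imp_le)
    qed (use d in \<open>auto simp: closed_segment_eq_real_ivl\<close>)
    then have "norm (\<phi> (x + d) - \<phi> x - d *\<^sub>R D x) \<le> d"
      using d by simp
    moreover have "norm (\<phi> (x + d) - \<phi> x) < 1"
      using d12(3)[of x "x + d"] x d by (simp add: dist_norm)
    moreover have "norm (d *\<^sub>R D x) \<le> norm (\<phi> (x + d) - \<phi> x) + norm (\<phi> (x + d) - \<phi> x - d *\<^sub>R D x)"
      using norm_triangle_ineq4[of "\<phi> (x + d) - \<phi> x" "\<phi> (x + d) - \<phi> x - d *\<^sub>R D x"] by simp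
    ultimately have "d * norm (D x) \<le> 1 + d"
      using d by simp
    then show ?thesis
      using d(1) by (simp add: field_simps)
  qed
  then show ?thesis
    unfolding bounded_iff by (intro exI[of _ "1 / d + 1"]) auto
qed

text \<open>Bounded factors take their values in a compact product, on which multiplication is
  uniformly continuous.\<close>

lemma uniformly_continuous_on_scaleR_bounded:
  fixes f :: "'a::metric_space \<Rightarrow> real" and g :: "'a \<Rightarrow> 'b::euclidean_space"
  assumes "uniformly_continuous_on S f" "uniformly_continuous_on S g"
    and "bounded (f ` S)" "bounded (g ` S)"
  shows "uniformly_continuous_on S (\<lambda>x. f x *\<^sub>R g x)"
proof -
  have "compact (closure (f ` S) \<times> closure (g ` S))"
    using assms(3,4) by (intro compact_Times) (simp_all add: compact_closure)
  then have "uniformly_continuous_on (closure (f ` S) \<times> closure (g ` S)) (\<lambda>p. fst p *\<^sub>R snd p)"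
    by (intro compact_uniformly_continuous continuous_intros)
  moreover have "(\<lambda>x. (f x, g x)) ` S \<subseteq> closure (f ` S) \<times> closure (g ` S)"
    using closure_subset[of "f ` S"] closure_subset[of "g ` S"] by auto
  ultimately show ?thesis
    using uniformly_continuous_on_compose_map[OF uniformly_continuous_on_Pair[OF assms(1,2)]]
    by fastforce
qed

lemma deriv_on_atLeast:
  assumes "C1_on {c..} u" "x \<ge> c"
  shows "(u has_vector_derivative deriv_on {c..} u x) (at x within {c..})"
proof -
  obtain D where D: "(u has_vector_derivative D) (at x within {c..})"
    using assms unfolding C1_on_def by auto
  moreover have "at x within {c..} \<noteq> bot"
    using assms(2) by (metis islimpt_Icc trivial_limit_within islimpt_subset Icc_subset_Ici_iff
        atLeast_iff atLeastAtMost_iff gt_ex less_eq_real_def order.refl order.trans)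
  ultimately show ?thesis
    unfolding deriv_on_def using vector_derivative_within by metis
qed

lemma precompact_C1_segments_compose:
  fixes u w :: "real \<Rightarrow> 'a::euclidean_space" and \<phi> :: "real \<Rightarrow> real"
  assumes h: "0 < h" and P: "precompact_in (C1_metric (-h) 0) P" "segment h u ` {t1..} \<subseteq> P"
    and C1: "C1_on {c..} \<phi>"
    and uc: "uniformly_continuous_on {c..} \<phi>" "uniformly_continuous_on {c..} (deriv_on {c..} \<phi>)"
    and lim: "filterlim \<phi> at_top at_top"
    and w: "\<And>s. s \<ge> b \<Longrightarrow> w s = u (\<phi> s)"
  shows "\<exists>s2\<ge>s0. \<exists>Q. precompact_in (C1_metric (-h) 0) Q \<and> segment h w ` {s2..} \<subseteq> Q"
proof -
  obtain D where D: "\<And>x. x \<ge> t1 \<Longrightarrow> (u has_vector_derivative D x) (at x)"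
    and u: "bounded (u ` {t1..})" "uniformly_continuous_on {t1..} u"
    and D_bd: "bounded (D ` {t1..})" "uniformly_continuous_on {t1..} D"
    using precompact_C1_segments_imp[OF h P] by metis
  define \<psi> where "\<psi> = deriv_on {c..} \<phi>"
  have \<psi>: "(\<phi> has_vector_derivative \<psi> x) (at x within {c..})" if "x \<ge> c" for x
    unfolding \<psi>_def using C1 that by (rule deriv_on_atLeast)
  note uc = uc[folded \<psi>_def]
  have \<psi>_bd: "bounded (\<psi> ` {c..})"
    using \<psi> uc by (rule uniformly_continuous_derivative_bounded)
  obtain a0 where a0: "\<And>s. s \<ge> a0 \<Longrightarrow> t1 \<le> \<phi> s"
    using lim unfolding filterlim_at_top eventually_at_top_linorder by meson
  \<comment> \<open>The extra 1 places \<open>{a..}\<close> strictly beyond \<open>b\<close> and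
    \<open>c\<close>. Each of its points then has a neighbourhood where \<open>w\<close> is the
    composition, and the derivative of \<open>\<phi>\<close> within \<open>{c..}\<close> is
    two-sided there.\<close>
  define a where "a = max s0 (max a0 (max b c)) + 1"
  have a: "a \<ge> s0" "a > c" "a > b" "\<And>s. s \<ge> a \<Longrightarrow> t1 \<le> \<phi> s"
    using a0 by (auto simp: a_def)
  have sub: "{a..} \<subseteq> {c..}"
    using a(2) by simp
  have uc': "uniformly_continuous_on {a..} \<phi>" "uniformly_continuous_on {a..} \<psi>"
    using uc sub unfolding uniformly_continuous_on_def by (meson subsetD)+
  have \<phi>_im: "\<phi> ` {a..} \<subseteq> {t1..}"
    using a(4) by auto
  have w_a: "w s = u (\<phi> s)" if "s \<ge> a" for s
    using w a(3) that by simp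
  have bd_w: "bounded (w ` {a..})"
    by (rule bounded_subset[OF u(1)]) (use w_a \<phi>_im in auto)
  have uc_w: "uniformly_continuous_on {a..} w"
    using uniformly_continuous_on_compose_map[OF uc'(1) u(2) \<phi>_im] w_a
    unfolding uniformly_continuous_on_def by simp
  have D\<phi>: "bounded ((\<lambda>s. D (\<phi> s)) ` {a..})" "uniformly_continuous_on {a..} (\<lambda>s. D (\<phi> s))"
    using bounded_subset[OF D_bd(1)] \<phi>_im uniformly_continuous_on_compose_map[OF uc'(1) D_bd(2) \<phi>_im]
    by (simp_all add: image_image[symmetric] image_mono)
  have \<psi>_bd_a: "bounded (\<psi> ` {a..})"
    using bounded_subset[OF \<psi>_bd image_mono[OF sub]] .
  \<comment> \<open>The chain-rule derivative of \<open>w\<close>; its uniform continuity rests on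
    both factors being bounded.\<close>
  define W where "W s = \<psi> s *\<^sub>R D (\<phi> s)" for s
  have uc_W: "uniformly_continuous_on {a..} W"
    unfolding W_def using uc'(2) D\<phi>(2) \<psi>_bd_a D\<phi>(1)
    by (rule uniformly_continuous_on_scaleR_bounded)
  have bd_W: "bounded (W ` {a..})"
  proof -
    obtain B1 B2 where B: "\<And>s. s \<ge> a \<Longrightarrow> norm (\<psi> s) \<le> B1" "\<And>s. s \<ge> a \<Longrightarrow> norm (D (\<phi> s)) \<le> B2"
      using \<psi>_bd_a D\<phi>(1) unfolding bounded_iff by auto
    have "norm (W s) \<le> B1 * B2" if "s \<ge> a" for s
      using mult_mono'[OF B(1)[OF that] B(2)[OF that]] by (simp add: W_def)
    then show ?thesis
      unfolding bounded_iff by auto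
  qed
  have "(w has_vector_derivative W s) (at s)" if s: "s \<ge> a" for s
  proof -
    have "(\<phi> has_vector_derivative \<psi> s) (at s)"
    proof -
      have "at s within {c..} = at s"
        using s a(2) by (intro at_within_interior) auto
      then show ?thesis
        using \<psi>[of s] s a(2) by simp
    qed
    then have "(u \<circ> \<phi> has_vector_derivative W s) (at s)"
      unfolding W_def using D[OF a(4)[OF s]] by (rule vector_diff_chain_at)
    then show ?thesis
      by (rule has_vector_derivative_transform_within_open[of _ _ _ "{b<..}"])
        (use w s a(3) in auto)
  qed
  then have "precompact_in (C1_metric (-h) 0) (segment h w ` {a + h..})"
    using bd_w uc_w bd_W uc_W by (rule precompact_C1_segmentsI[OF h])
  then show ?thesis
    using a(1) h by (intro exI[of _ "a + h"] conjI exI[of _ "segment h w ` {a + h..}"]) auto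
qed

section \<open>The deviating argument and the time transformation\<close>

text \<open>With the integrating factor \<open>exp (\<mu> * t)\<close>, the derivatives of the
  weighted \<open>\<eta>\<close> and of the weighted \<open>2 * \<eta>t - \<eta>\<close> are the
  factor times \<open>\<mu> * \<eta>t\<close> plus or minus \<open>\<gamma>\<close>, which is
  nonnegative. Both quantities therefore keep their initial sign.\<close>

lemma delay_bounds:
  fixes \<eta> :: "real \<Rightarrow> real"
  assumes cont: "continuous_on {t0..} \<eta>"
    and der: "\<And>t. t > t0 \<Longrightarrow> (\<eta> has_real_derivative - \<mu> * (\<eta> t - \<eta>t) + \<gamma> t) (at t)"
    and \<gamma>: "\<And>t. \<bar>\<gamma> t\<bar> \<le> \<mu> * \<eta>t"
    and init: "0 \<le> \<eta> t0" "\<eta> t0 \<le> 2 * \<eta>t" and t: "t \<ge> t0"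
  shows "0 \<le> \<eta> t" "\<eta> t \<le> 2 * \<eta>t"
proof -
  have cont': "continuous_on {t0..t} \<eta>"
    using cont by (rule continuous_on_subset) auto
  have "exp (\<mu> * t0) * \<eta> t0 \<le> exp (\<mu> * t) * \<eta> t"
  proof (rule DERIV_nonneg_imp_increasing_open[OF t])
    show "\<exists>y. ((\<lambda>s. exp (\<mu> * s) * \<eta> s) has_real_derivative y) (at x) \<and> y \<ge> 0"
      if "t0 < x" "x < t" for x
    proof (intro exI conjI)
      show "((\<lambda>s. exp (\<mu> * s) * \<eta> s) has_real_derivative exp (\<mu> * x) * (\<mu> * \<eta>t + \<gamma> x)) (at x)"
        by (rule derivative_eq_intros der that refl)+ (simp add: algebra_simps)
      show "exp (\<mu> * x) * (\<mu> * \<eta>t + \<gamma> x) \<ge> 0"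
        using \<gamma>[of x] by simp
    qed
  qed (intro continuous_intros cont')
  moreover have "exp (\<mu> * t0) * \<eta> t0 \<ge> 0"
    using init by simp
  ultimately show "0 \<le> \<eta> t"
    by (smt (verit) exp_gt_zero mult_pos_neg)
  have "exp (\<mu> * t0) * (2 * \<eta>t - \<eta> t0) \<le> exp (\<mu> * t) * (2 * \<eta>t - \<eta> t)"
  proof (rule DERIV_nonneg_imp_increasing_open[OF t])
    show "\<exists>y. ((\<lambda>s. exp (\<mu> * s) * (2 * \<eta>t - \<eta> s)) has_real_derivative y) (at x) \<and> y \<ge> 0"
      if "t0 < x" "x < t" for x
    proof (intro exI conjI)
      show "((\<lambda>s. exp (\<mu> * s) * (2 * \<eta>t - \<eta> s)) has_real_derivative
              exp (\<mu> * x) * (\<mu> * \<eta>t - \<gamma> x)) (at x)"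
        by (rule derivative_eq_intros der that refl)+ (simp add: algebra_simps)
      show "exp (\<mu> * x) * (\<mu> * \<eta>t - \<gamma> x) \<ge> 0"
        using \<gamma>[of x] by simp
    qed
  qed (intro continuous_intros cont')
  moreover have "exp (\<mu> * t0) * (2 * \<eta>t - \<eta> t0) \<ge> 0"
    using init by simp
  ultimately show "\<eta> t \<le> 2 * \<eta>t"
    by (smt (verit) exp_gt_zero mult_pos_neg)
qed

text \<open>Since \<open>\<eta>\<close> stays nonnegative, its derivative is at most
  \<open>2 * \<mu> * \<eta>t\<close>, which is below 1; this is where the constant
  \<open>1 / 2\<close> comes from.\<close>

lemma deviating_argument_strict_mono:
  fixes \<eta> :: "real \<Rightarrow> real"
  assumes cont: "continuous_on {t0..} \<eta>"
    and der: "\<And>t. t > t0 \<Longrightarrow> (\<eta> has_real_derivative - \<mu> * (\<eta> t - \<eta>t) + \<gamma> t) (at t)"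
    and \<gamma>: "\<And>t. \<bar>\<gamma> t\<bar> \<le> \<mu> * \<eta>t" and \<eta>t: "0 < \<eta>t" "\<mu> * \<eta>t < 1 / 2"
    and init: "0 \<le> \<eta> t0" "\<eta> t0 \<le> 2 * \<eta>t"
  shows "strict_mono_on {t0..} (\<lambda>t. t - \<eta> t)"
proof (rule strict_mono_onI)
  fix a b assume ab: "a \<in> {t0..}" "b \<in> {t0..}" "a < b"
  \<comment> \<open>The bound on \<open>\<gamma>\<close> forces \<open>\<mu> * \<eta>t\<close> to be
    nonnegative, and \<open>\<eta>t\<close> is positive.\<close>
  have \<mu>: "\<mu> \<ge> 0"
    using \<gamma>[of 0] \<eta>t(1) by (smt (verit) mult_neg_pos)
  show "a - \<eta> a < b - \<eta> b"
  proof (rule DERIV_pos_imp_increasing_open[OF \<open>a < b\<close>])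
    show "\<exists>y. ((\<lambda>t. t - \<eta> t) has_real_derivative y) (at x) \<and> y > 0" if "a < x" "x < b" for x
    proof (intro exI conjI)
      have x: "x > t0" using ab that by simp
      show "((\<lambda>t. t - \<eta> t) has_real_derivative 1 - (- \<mu> * (\<eta> x - \<eta>t) + \<gamma> x)) (at x)"
        by (intro DERIV_diff DERIV_ident der x)
      have "0 \<le> \<eta> x"
        by (rule delay_bounds(1)[OF cont der \<gamma> init]) (use x in auto)
      then have "\<mu> * \<eta> x \<ge> 0"
        using \<mu> by simp
      then have "- \<mu> * (\<eta> x - \<eta>t) \<le> \<mu> * \<eta>t"
        by (simp add: algebra_simps)
      then show "1 - (- \<mu> * (\<eta> x - \<eta>t) + \<gamma> x) > 0"
        using \<gamma>[of x] \<eta>t(2) by linarith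
    qed
    show "continuous_on {a..b} (\<lambda>t. t - \<eta> t)"
      using ab by (intro continuous_intros continuous_on_subset[OF cont]) auto
  qed
qed

section \<open>Inverses on half-lines and continuity of the time transformation\<close>

lemma range_of_continuous_at_top:
  fixes \<sigma> :: "real \<Rightarrow> real"
  assumes "continuous_on {a..} \<sigma>" "filterlim \<sigma> at_top at_top" "\<sigma> a \<le> x"
  shows "\<exists>t\<ge>a. \<sigma> t = x"
proof -
  obtain N where N: "\<And>t. t \<ge> N \<Longrightarrow> x \<le> \<sigma> t"
    using assms(2) unfolding filterlim_at_top eventually_at_top_linorder by meson
  have "continuous_on {a..max a N} \<sigma>"
    using assms(1) by (rule continuous_on_subset) auto
  then show ?thesis
    using IVT'[of \<sigma> a x "max a N"] assms(3) N[of "max a N"] by auto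
qed

text \<open>The upper end \<open>b\<close> confines the preimages to a compact interval
  \<open>{a..T}\<close>, and a continuous injection of a compact set has a continuous
  inverse.\<close>

lemma continuous_on_inv_into_strict_mono:
  fixes \<sigma> :: "real \<Rightarrow> real"
  assumes cont: "continuous_on {a..} \<sigma>" and lim: "filterlim \<sigma> at_top at_top"
    and mono: "strict_mono_on {a..} \<sigma>"
  shows "continuous_on {\<sigma> a..b} (inv_into {a..} \<sigma>)"
proof (cases "\<sigma> a \<le> b")
  case True
  then obtain T where T: "T \<ge> a" "\<sigma> T = b"
    using range_of_continuous_at_top[OF cont lim] by blast
  have "continuous_on (\<sigma> ` {a..T}) (inv_into {a..} \<sigma>)"
  proof (rule continuous_on_inv)
    show "continuous_on {a..T} \<sigma>"
      using cont by (rule continuous_on_subset) auto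
    show "\<forall>x\<in>{a..T}. inv_into {a..} \<sigma> (\<sigma> x) = x"
      using strict_mono_on_imp_inj_on[OF mono] by (auto intro: inv_into_f_f)
  qed simp
  moreover have "{\<sigma> a..b} \<subseteq> \<sigma> ` {a..T}"
  proof
    fix x assume "x \<in> {\<sigma> a..b}"
    moreover have "continuous_on {a..T} \<sigma>"
      using cont by (rule continuous_on_subset) auto
    ultimately show "x \<in> \<sigma> ` {a..T}"
      using IVT'[of \<sigma> a x T] T by force
  qed
  ultimately show ?thesis
    by (rule continuous_on_subset)
qed simp

lemma continuous_on_time_transformation:
  fixes \<sigma> \<omega> :: "real \<Rightarrow> real"
  assumes h: "h > 0"
    and \<sigma>: "continuous_on {t0..} \<sigma>" "filterlim \<sigma> at_top at_top" "strict_mono_on {t0..} \<sigma>"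
    and \<omega>: "continuous_on {s0 - h..s0} \<omega>" "\<And>s. s \<in> {s0 - h..s0} \<Longrightarrow> \<sigma> t0 \<le> \<omega> s"
      "\<omega> s0 = t0" "\<omega> (s0 - h) = \<sigma> t0" and \<sigma>_le: "\<sigma> t0 \<le> t0"
  shows "continuous_on {s0 - h..} (time_transformation h t0 s0 \<sigma> \<omega>)"
proof -
  let ?\<alpha> = "time_transformation h t0 s0 \<sigma> \<omega>"
  let ?inv = "inv_into {t0..} \<sigma>"
  have inj: "inj_on \<sigma> {t0..}"
    using \<sigma>(3) by (rule strict_mono_on_imp_inj_on)
  have \<alpha>_init: "?\<alpha> s = \<omega> s" if "s \<le> s0" for s
    using that by (simp add: time_transformation.simps[of _ _ _ _ _ s])
  \<comment> \<open>The recursion also holds at \<open>s0\<close>, where both sides equal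
    \<open>t0\<close> by the matching conditions on \<omega>. Consecutive pieces can therefore be
    glued on closed intervals.\<close>
  have \<alpha>_step: "?\<alpha> s = ?inv (?\<alpha> (s - h))" if "s \<ge> s0" for s
  proof (cases "s = s0")
    case True
    then show ?thesis
      using \<alpha>_init[of s0] \<alpha>_init[of "s0 - h"] h \<omega>(3,4) inj by (simp add: inv_into_f_f)
  next
    case False
    then show ?thesis
      using that h by (subst time_transformation.simps) auto
  qed
  have inv_ge: "?inv x \<ge> t0" if x: "x \<ge> \<sigma> t0" for x
  proof -
    have "x \<in> \<sigma> ` {t0..}"
      using range_of_continuous_at_top[OF \<sigma>(1,2) x] by auto
    from inv_into_into[OF this] show ?thesis
      by simp
  qed
  \<comment> \<open>The lower bound strengthens the induction: it keeps the values in the range of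
    \<sigma>, where \<open>?inv\<close> is a true inverse.\<close>
  have main: "continuous_on {s0 - h..s0 + real n * h} ?\<alpha> \<and>
              (\<forall>s\<in>{s0 - h..s0 + real n * h}. \<sigma> t0 \<le> ?\<alpha> s)" for n
  proof (induction n)
    case 0
    have "continuous_on {s0 - h..s0} ?\<alpha>"
      using \<omega>(1) by (subst continuous_on_cong[OF refl, where g = \<omega>]) (auto simp: \<alpha>_init)
    then show ?case
      using \<omega>(2) by (auto simp: \<alpha>_init)
  next
    case (Suc n)
    let ?b = "s0 + real n * h"
    have b: "?b \<ge> s0" "s0 + real (Suc n) * h = ?b + h"
      using h by (auto simp: algebra_simps)
    have ge: "\<sigma> t0 \<le> ?\<alpha> s" if "s \<in> {s0 - h..?b}" for s
      using Suc that by blast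
    have shift: "s - h \<in> {s0 - h..?b}" if "s \<in> {s0..?b + h}" for s
      using that by auto
    have shift_cont: "continuous_on {s0..?b + h} (\<lambda>s. ?\<alpha> (s - h))"
      using Suc shift by (intro continuous_on_compose2[OF conjunct1[OF Suc]] continuous_intros) auto
    then have "bdd_above ((\<lambda>s. ?\<alpha> (s - h)) ` {s0..?b + h})"
      by (intro bounded_imp_bdd_above compact_imp_bounded compact_continuous_image) auto
    then obtain M where M: "\<And>s. s \<in> {s0..?b + h} \<Longrightarrow> ?\<alpha> (s - h) \<le> M"
      unfolding bdd_above_def by fastforce
    have "continuous_on {s0..?b + h} (\<lambda>s. ?inv (?\<alpha> (s - h)))"
      by (rule continuous_on_compose2[OF continuous_on_inv_into_strict_mono[OF \<sigma>, of M] shift_cont])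
        (use M ge[OF shift] in auto)
    then have "continuous_on {s0..?b + h} ?\<alpha>"
      by (subst continuous_on_cong[OF refl, where g = "\<lambda>s. ?inv (?\<alpha> (s - h))"]) (auto simp: \<alpha>_step)
    then have "continuous_on ({s0 - h..?b} \<union> {s0..?b + h}) ?\<alpha>"
      using Suc by (intro continuous_on_closed_Un) auto
    moreover have un: "{s0 - h..?b} \<union> {s0..?b + h} = {s0 - h..?b + h}"
    proof -
      have "{s0 - h..b} \<union> {s0..b + h} = {s0 - h..b + h}" if "s0 \<le> b" for b
        using that h by auto
      then show ?thesis
        using b(1) .
    qed
    \<comment> \<open>Values of \<open>?inv\<close> on the range of \<sigma> are at least
      \<open>t0\<close>, which in turn is at least \<open>\<sigma> t0\<close>.\<close>
    moreover have "\<sigma> t0 \<le> ?\<alpha> s" if "s \<in> {s0..?b + h}" for s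
    proof -
      have "t0 \<le> ?inv (?\<alpha> (s - h))"
        by (intro inv_ge ge shift that)
      then show ?thesis
        using that \<sigma>_le by (simp add: \<alpha>_step)
    qed
    ultimately show ?case
      using ge unfolding b(2) un[symmetric] by auto
  qed
  \<comment> \<open>Continuity is local: choosing \<open>n\<close> with \<open>s\<close> strictly
    below the right end of a piece makes that piece a neighbourhood of \<open>s\<close> within the
    half-line.\<close>
  have "continuous (at s within {s0 - h..}) ?\<alpha>" if s: "s \<ge> s0 - h" for s
  proof -
    obtain n :: nat where n: "(s - s0) / h < real n"
      using reals_Archimedean2 by blast
    then have sn: "s < s0 + real n * h"
      using h by (simp add: field_simps)
    have "continuous_on ({s0 - h..} \<inter> {..<s0 + real n * h}) ?\<alpha>"
      by (rule continuous_on_subset[OF conjunct1[OF main[of n]]]) auto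
    then have "continuous (at s within ({s0 - h..} \<inter> {..<s0 + real n * h})) ?\<alpha>"
      using s sn by (simp add: continuous_on_eq_continuous_within)
    moreover have "at s within ({s0 - h..} \<inter> {..<s0 + real n * h}) = at s within {s0 - h..}"
      by (rule at_within_nhd[of s "{..<s0 + real n * h}"]) (use sn in auto)
    ultimately show ?thesis
      by simp
  qed
  then show ?thesis
    by (simp add: continuous_on_eq_continuous_within)
qed

text \<open>\<open>\<alpha>\<close> is bounded on the compact \<open>{a..Z}\<close>, so whichever
  preimage \<open>inv_into\<close> picks for a value above that bound must lie beyond
  \<open>Z\<close>.\<close>

lemma filterlim_inv_into_at_top:
  fixes \<alpha> :: "real \<Rightarrow> real"
  assumes cont: "continuous_on {a..} \<alpha>" and lim: "filterlim \<alpha> at_top at_top"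
  shows "filterlim (inv_into {a..} \<alpha>) at_top at_top"
  unfolding filterlim_at_top
proof
  fix Z :: real
  have "continuous_on {a..Z} \<alpha>"
    using cont by (rule continuous_on_subset) auto
  then have "bdd_above (\<alpha> ` {a..Z})"
    by (intro bounded_imp_bdd_above compact_imp_bounded compact_continuous_image) auto
  then obtain M where M: "\<And>s. s \<in> {a..Z} \<Longrightarrow> \<alpha> s \<le> M"
    unfolding bdd_above_def by fastforce
  have "Z \<le> inv_into {a..} \<alpha> t" if t: "t > max M (\<alpha> a)" for t
  proof -
    have "t \<in> \<alpha> ` {a..}"
      using range_of_continuous_at_top[OF cont lim, of t] t by auto
    then have "\<alpha> (inv_into {a..} \<alpha> t) = t" "inv_into {a..} \<alpha> t \<in> {a..}"
      by (rule f_inv_into_f, rule inv_into_into)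
    then show ?thesis
      using M[of "inv_into {a..} \<alpha> t"] t by force
  qed
  then show "\<forall>\<^sub>F t in at_top. Z \<le> inv_into {a..} \<alpha> t"
    unfolding eventually_at_top_dense by blast
qed

text \<open>Provides the base of the induction for \<alpha>: the initial time function starts at the
  value of the deviating argument at \<open>t0\<close> and never falls below it.\<close>

lemma admissible_initial_time_ge:
  assumes "admissible_initial_time h t0 s0 \<eta>0 \<omega>" "s \<in> {s0 - h..s0}"
  shows "\<omega> (s0 - h) \<le> \<omega> s"
proof (cases "s = s0 - h")
  case False
  then have less: "s0 - h < s" "s0 - h < s0"
    using assms(2) by auto
  obtain D where D: "\<And>x. x \<in> {s0 - h..s0} \<Longrightarrow> (\<omega> has_vector_derivative D x) (at x within {s0 - h..s0})"
    using assms(1) unfolding admissible_initial_time_def C1_on_def by blast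
  have pos: "D x > 0" if "x \<in> {s0 - h..s0}" for x
    using assms(1) that deriv_on_Icc_eqI[OF less(2) that D[OF that]]
    unfolding admissible_initial_time_def by metis
  have "\<omega> (s0 - h) < \<omega> s"
  proof (rule DERIV_pos_imp_increasing_open[OF less(1)])
    show "\<exists>y. (\<omega> has_real_derivative y) (at x) \<and> y > 0" if "s0 - h < x" "x < s" for x
    proof (intro exI conjI)
      have x: "x \<in> {s0 - h<..<s0}"
        using that assms(2) by auto
      then have "at x within {s0 - h..s0} = at x"
        by (intro at_within_interior) auto
      then show "(\<omega> has_real_derivative D x) (at x)"
        using D[of x] x by (simp add: has_real_derivative_iff_has_vector_derivative)
      show "D x > 0"
        using pos x by auto
    qed
    have "continuous_on {s0 - h..s0} \<omega>"
      using assms(1) unfolding admissible_initial_time_def by (auto intro: C1_on_imp_continuous_on)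
    then show "continuous_on {s0 - h..s} \<omega>"
      by (rule continuous_on_subset) (use assms(2) in auto)
  qed
  then show ?thesis
    by simp
qed simp

section \<open>Application to the delay system\<close>

theorem mainTheorem5:
  fixes f :: "real \<times> (real ^ 'm) \<times> (real ^ 'm) \<Rightarrow> real ^ 'm"
    and G :: "real ^ 'm \<Rightarrow> real"
    and t0 s0 \<mu> \<eta>t h \<eta>0 :: real
    and g y z :: "real \<Rightarrow> real ^ 'm"
    and \<eta> \<omega> \<alpha> \<alpha>inv :: "real \<Rightarrow> real"
  assumes "\<eta>t > 0" and "h = 2 * \<eta>t"
    and "\<exists>L. L-lipschitz_on UNIV f" and "\<exists>L. L-lipschitz_on UNIV G"
    and "\<And>x. \<bar>G x\<bar> \<le> \<mu> * \<eta>t" and "\<mu> * \<eta>t < 1 / 2"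
    and "C1_on {t0 - h..t0} g" and "\<eta>0 \<in> {0<..2 * \<eta>t}"
    and "SDD_solution f G \<mu> \<eta>t h t0 g \<eta>0 y \<eta>"
    and "admissible_initial_time h t0 s0 \<eta>0 \<omega>"
    and "\<alpha> = time_transformation h t0 s0 (\<lambda>t. t - \<eta> t) \<omega>"
    and "\<alpha>inv = inv_into {s0 - h..} \<alpha>"
    and "\<And>s. s \<ge> s0 - h \<Longrightarrow> z s = y (\<alpha> s)"
    and "filterlim \<alpha> at_top at_top"
  shows
    "((\<exists>t1\<ge>t0. \<exists>P. precompact_in (C_metric (-h) 0) P \<and> segment h y ` {t1..} \<subseteq> P) \<and>
      (\<exists>s1\<ge>s0. uniformly_continuous_on {s1..} \<alpha>)
      \<longrightarrow> (\<exists>s2\<ge>s0. \<exists>P. precompact_in (C_metric (-h) 0) P \<and> segment h z ` {s2..} \<subseteq> P))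
     \<and>
     ((\<exists>s1\<ge>s0. \<exists>P. precompact_in (C_metric (-h) 0) P \<and> segment h z ` {s1..} \<subseteq> P) \<and>
      (\<exists>t1\<ge>t0. uniformly_continuous_on {t1..} \<alpha>inv)
      \<longrightarrow> (\<exists>t2\<ge>t0. \<exists>P. precompact_in (C_metric (-h) 0) P \<and> segment h y ` {t2..} \<subseteq> P))
     \<and>
     ((\<exists>t1\<ge>t0. \<exists>P. precompact_in (C1_metric (-h) 0) P \<and> segment h y ` {t1..} \<subseteq> P) \<and>
      (\<exists>s1\<ge>s0. C1_on {s1..} \<alpha> \<and> bdd_above (deriv_on {s1..} \<alpha> ` {s1..}) \<and>
         uniformly_continuous_on {s1..} \<alpha> \<and>
         uniformly_continuous_on {s1..} (deriv_on {s1..} \<alpha>))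
      \<longrightarrow> (\<exists>s2\<ge>s0. \<exists>P. precompact_in (C1_metric (-h) 0) P \<and> segment h z ` {s2..} \<subseteq> P))
     \<and>
     ((\<exists>s1\<ge>s0. \<exists>P. precompact_in (C1_metric (-h) 0) P \<and> segment h z ` {s1..} \<subseteq> P) \<and>
      (\<exists>t1\<ge>t0. C1_on {t1..} \<alpha>inv \<and> bdd_above (deriv_on {t1..} \<alpha>inv ` {t1..}) \<and>
         uniformly_continuous_on {t1..} \<alpha>inv \<and>
         uniformly_continuous_on {t1..} (deriv_on {t1..} \<alpha>inv))
      \<longrightarrow> (\<exists>t2\<ge>t0. \<exists>P. precompact_in (C1_metric (-h) 0) P \<and> segment h y ` {t2..} \<subseteq> P))"
proof -
  have h: "h > 0"
    using assms(1,2) by simp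
  have sol: "continuous_on {t0..} \<eta>" "\<eta> t0 = \<eta>0"
    "\<And>t. t > t0 \<Longrightarrow> (\<eta> has_real_derivative - \<mu> * (\<eta> t - \<eta>t) + G (y t)) (at t)"
    using assms(9) unfolding SDD_solution_def by auto
  have init: "0 \<le> \<eta> t0" "\<eta> t0 \<le> 2 * \<eta>t"
    using assms(8) sol(2) by auto
  have \<omega>: "C1_on {s0 - h..s0} \<omega>" "\<omega> s0 = t0" "\<omega> (s0 - h) = t0 - \<eta>0"
    using assms(10) unfolding admissible_initial_time_def by auto
  let ?\<sigma> = "\<lambda>t. t - \<eta> t"
  \<comment> \<open>The delay never exceeds \<open>2 * \<eta>t\<close>, so the deviating argument
    trails \<open>t\<close> by a bounded amount.\<close>
  have \<sigma>_lim: "filterlim ?\<sigma> at_top at_top"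
  proof (rule filterlim_at_top_mono)
    show "filterlim (\<lambda>t. - (2 * \<eta>t) + t) at_top at_top"
      by (rule filterlim_tendsto_add_at_top[OF tendsto_const filterlim_ident])
    show "\<forall>\<^sub>F t in at_top. - (2 * \<eta>t) + t \<le> t - \<eta> t"
      using eventually_ge_at_top[of t0]
      by eventually_elim (use delay_bounds(2)[OF sol(1,3) assms(5) init] in force)
  qed
  have cont: "continuous_on {s0 - h..} \<alpha>"
    unfolding assms(11)
  proof (rule continuous_on_time_transformation[OF h _ \<sigma>_lim])
    show "continuous_on {t0..} ?\<sigma>"
      by (intro continuous_intros sol(1))
    show "strict_mono_on {t0..} ?\<sigma>"
      by (rule deviating_argument_strict_mono[OF sol(1,3) assms(5,1,6) init])
    show "continuous_on {s0 - h..s0} \<omega>"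
      using \<omega>(1) by (rule C1_on_imp_continuous_on)
    show "t0 - \<eta> t0 \<le> \<omega> s" if "s \<in> {s0 - h..s0}" for s
      using admissible_initial_time_ge[OF assms(10) that] \<omega>(3) sol(2) by simp
  qed (use \<omega> sol(2) init in auto)
  have inv_lim: "filterlim \<alpha>inv at_top at_top"
    unfolding assms(12) using cont assms(14) by (rule filterlim_inv_into_at_top)
  \<comment> \<open>Every such \<open>t\<close> is a value of \<alpha>, hence
    \<open>\<alpha>inv t\<close> is a preimage of it and the definition of \<open>z\<close> applies
    there.\<close>
  have y: "y t = z (\<alpha>inv t)" if "t \<ge> \<alpha> (s0 - h)" for t
  proof -
    have "t \<in> \<alpha> ` {s0 - h..}"
      using range_of_continuous_at_top[OF cont assms(14) that] by auto
    then have "\<alpha> (\<alpha>inv t) = t" "\<alpha>inv t \<in> {s0 - h..}"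
      unfolding assms(12) by (rule f_inv_into_f, rule inv_into_into)
    then show ?thesis
      using assms(13)[of "\<alpha>inv t"] by simp
  qed
  \<comment> \<open>The two transfer lemmas are each used twice: with \<alpha> from \<open>y\<close>
    to \<open>z\<close>, where the composition holds from \<open>s0 - h\<close> on, and with
    \<open>\<alpha>inv\<close> from \<open>z\<close> to \<open>y\<close>, where it holds from
    \<open>\<alpha> (s0 - h)\<close> on.\<close>
  show ?thesis
    by (intro conjI impI; elim conjE exE;
        (rule precompact_C_segments_compose[where u = y and w = z, OF h _ _ _ assms(14,13)]
          precompact_C_segments_compose[where u = z and w = y, OF h _ _ _ inv_lim y]
          precompact_C1_segments_compose[where u = y and w = z, OF h _ _ _ _ _ assms(14,13)]
          precompact_C1_segments_compose[where u = z and w = y, OF h _ _ _ _ _ inv_lim y]; assumption))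
qed

end
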